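(* Let $k$ be a positive integer and let $G$ be a non-bipartite graph of order $n\geqslant 2k+4$ that contains none of the cycles $C_3,C_5,\ldots,C_{2k+1}$ as a subgraph. Then $$\lambda_1(G)\leqslant \lambda_1\!\left(R_k\!\left(K_{\lfloor(n-2k+1)/2\rfloor,\lceil(n-2k+1)/2\rceil}\right)\right),$$ with equality if and only if $G\cong R_k\!\left(K_{\lfloor(n-2k+1)/2\rfloor,\lceil(n-2k+1)/2\rceil}\right)$.
   Context: All graphs are finite, simple and undirected; $\lambda_1(G)$ is the largest eigenvalue of the adjacency matrix of $G$. $K_{s,t}$ is the complete bipartite graph with parts of sizes $s$ and $t$, and $C_m$ is the cycle on $m$ vertices. For positive integers $s,t,k$, $R_k(K_{s,t})$ is the graph obtained from $K_{s,t}$ by replacing one of its edges $uv$ with a path on $2k+1$ vertices from $u$ to $v$ (i.e., deleting $uv$ and adding new vertices $u_1,\ldots,u_{2k-1}$ and the path $uu_1u_2\cdots u_{2k-1}v$); it has $s+t+2k-1$ vertices. *)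

theory Defs
  imports "Graph_Theory.Graph_Theory" "Jordan_Normal_Form.Spectral_Radius"
begin

text \<open>
  A finite simple undirected graph is a \<^term>\<open>pair_graph\<close> of the Graph_Theory entry: finite,
  loop-free, with a symmetric arc relation, so an edge \<open>uv\<close> is the pair of arcs \<open>(u,v)\<close>, \<open>(v,u)\<close>.
\<close>

definition contains_subgraph :: "'a pair_pre_digraph \<Rightarrow> 'b pair_pre_digraph \<Rightarrow> bool" where
  "contains_subgraph G F \<longleftrightarrow>
     (\<exists>H. subgraph H (with_proj G) \<and> digraph_iso (with_proj F) H)"

definition bipartite :: "'a pair_pre_digraph \<Rightarrow> bool" where
  "bipartite G \<longleftrightarrow> (\<exists>U V. pverts G = U \<union> V \<and> U \<inter> V = {} \<and> parcs G \<subseteq> U \<times> V \<union> V \<times> U)"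

text \<open>This is the cycle \<open>C\<^sub>m\<close> for \<open>m \<ge> 3\<close> only.\<close>

definition cycle_graph :: "nat \<Rightarrow> nat pair_pre_digraph" where
  "cycle_graph m = \<lparr> pverts = {0..<m}, parcs = symcl {(i, Suc i mod m) | i. i < m} \<rparr>"

definition complete_bipartite_graph :: "nat \<Rightarrow> nat \<Rightarrow> nat pair_pre_digraph" where
  "complete_bipartite_graph s t =
     \<lparr> pverts = {0..<s + t}, parcs = symcl ({0..<s} \<times> {s..<s + t}) \<rparr>"

text \<open>
  Replaces the edge \<open>uv\<close> by the path with successive vertices \<open>u, ws, v\<close>, where \<open>ws\<close> is a list of
  distinct vertices outside the graph.
\<close>

definition replace_edge_by_path ::
  "'a pair_pre_digraph \<Rightarrow> 'a \<Rightarrow> 'a \<Rightarrow> 'a list \<Rightarrow> 'a pair_pre_digraph" where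
  "replace_edge_by_path G u v ws =
     \<lparr> pverts = pverts G \<union> set ws,
       parcs = (parcs G - {(u, v), (v, u)}) \<union> symcl (set (vwalk_arcs (u # ws @ [v]))) \<rparr>"

text \<open>
  \<open>R\<^sub>k(K\<^sub>s\<^sub>,\<^sub>t)\<close> for positive \<open>s\<close>, \<open>t\<close>, \<open>k\<close>. The replaced edge joins \<open>0\<close> and \<open>s\<close>, the first vertices of
  the two parts; any other edge gives an isomorphic graph. There are \<open>2k - 1\<close> new vertices.
\<close>

definition R_graph :: "nat \<Rightarrow> nat \<Rightarrow> nat \<Rightarrow> nat pair_pre_digraph" where
  "R_graph k s t =
     replace_edge_by_path (complete_bipartite_graph s t) 0 s [s + t..<s + t + 2 * k - 1]"

definition adjacency_matrix :: "'a pair_pre_digraph \<Rightarrow> 'a list \<Rightarrow> real mat" where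
  "adjacency_matrix G vs =
     mat (length vs) (length vs) (\<lambda>(i, j). if (vs ! i, vs ! j) \<in> parcs G then 1 else 0)"

text \<open>
  The matrix depends on an enumeration \<open>vs\<close> of the vertices, its eigenvalues do not; see
  \<open>eigenvalue_adjacency_matrix_enumeration\<close> below. The maximum is over a finite nonempty set, see
  \<open>graph_eigenvalues_finite_nonempty\<close> (graphs with at least one vertex).
\<close>

definition graph_eigenvalues :: "'a pair_pre_digraph \<Rightarrow> real set" where
  "graph_eigenvalues G =
     {x. \<exists>vs. distinct vs \<and> set vs = pverts G \<and> eigenvalue (adjacency_matrix G vs) x}"

definition lambda1 :: "'a pair_pre_digraph \<Rightarrow> real" where
  "lambda1 G = Max (graph_eigenvalues G)"


lemma complete_bipartite_graph_library:
  "complete_bipartite_digraph s t (with_proj (complete_bipartite_graph s t))"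
proof -
  have "{0..<s + t} = {0..<s} \<union> {s..<s + t}" "{0..<s} \<inter> {s..<s + t} = {}"
    by auto
  moreover have "symcl ({0..<s} \<times> {s..<s + t}) = {0..<s} \<times> {s..<s + t} \<union> {s..<s + t} \<times> {0..<s}"
    by (auto simp: symcl_def)
  ultimately show ?thesis
    unfolding complete_bipartite_digraph_pair_def complete_bipartite_graph_def
    by (intro conjI exI[of _ "{0..<s}"] exI[of _ "{s..<s + t}"]) simp_all
qed

lemma set_vwalk_arcs_upt:
  "set (vwalk_arcs (u # [a..<b] @ [v])) =
     (if a < b then {(u, a), (b - 1, v)} \<union> {(i, Suc i) | i. a \<le> i \<and> Suc i < b} else {(u, v)})"
proof (induction "b - a" arbitrary: a u)
  case 0
  then show ?case by auto
next
  case (Suc n)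
  then have ab: "a < b" and n: "n = b - Suc a" by auto
  have "set (vwalk_arcs (u # [a..<b] @ [v])) =
      insert (u, a) (set (vwalk_arcs (a # [Suc a..<b] @ [v])))"
    using ab by (simp add: upt_conv_Cons)
  also have "\<dots> = {(u, a), (b - 1, v)} \<union> {(i, Suc i) | i. a \<le> i \<and> Suc i < b}"
  proof (cases "Suc a < b")
    case True
    then have "set (vwalk_arcs (a # [Suc a..<b] @ [v])) =
      {(a, Suc a), (b - 1, v)} \<union> {(i, Suc i) | i. Suc a \<le> i \<and> Suc i < b}"
      using Suc(1)[OF n, of a] by simp
    moreover have "{(i, Suc i) | i. a \<le> i \<and> Suc i < b} =
       insert (a, Suc a) {(i, Suc i) | i. Suc a \<le> i \<and> Suc i < b}"
      using True by (auto simp: le_less Suc_le_eq)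
    ultimately show ?thesis by auto
  next
    case False
    then show ?thesis using Suc(1)[OF n, of a] ab by auto
  qed
  finally show ?case using ab by simp
qed

lemma symcl_iff: "(a, b) \<in> symcl R \<longleftrightarrow> (a, b) \<in> R \<or> (b, a) \<in> R"
  by (force simp: symcl_def)

lemma pair_graph_R_graph:
  assumes "s \<ge> 1" "t \<ge> 1" "k \<ge> 1"
  shows "pair_graph (R_graph k s t)" "card (pverts (R_graph k s t)) = s + t + 2 * k - 1"
proof -
  have V: "pverts (R_graph k s t) = {0..<s + t + 2 * k - 1}"
    using assms by (auto simp: R_graph_def replace_edge_by_path_def complete_bipartite_graph_def)
  have E: "parcs (R_graph k s t) = (symcl ({0..<s} \<times> {s..<s + t}) - {(0, s), (s, 0)}) \<union>
     symcl ({(0, s + t), (s + t + 2 * k - 2, s)} \<union>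
       {(i, Suc i) | i. s + t \<le> i \<and> Suc i < s + t + 2 * k - 1})"
  proof -
    have "s + t < s + t + 2 * k - 1" "s + t + 2 * k - 1 - 1 = s + t + 2 * k - 2"
      using assms by auto
    then show ?thesis
      unfolding R_graph_def replace_edge_by_path_def complete_bipartite_graph_def
        set_vwalk_arcs_upt by simp
  qed
  have sub: "parcs (R_graph k s t) \<subseteq> {0..<s + t + 2 * k - 1} \<times> {0..<s + t + 2 * k - 1}"
    unfolding E symcl_def using assms by auto
  then have fin: "finite (parcs (R_graph k s t))"
    by (rule finite_subset) simp
  show "pair_graph (R_graph k s t)"
  proof unfold_locales
    show "finite (pverts (R_graph k s t))" by (simp add: V)
    show "finite (parcs (R_graph k s t))" by (rule fin)
    show "fst e \<in> pverts (R_graph k s t)" "snd e \<in> pverts (R_graph k s t)"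
      if "e \<in> parcs (R_graph k s t)" for e
      using that sub unfolding V by auto
    show "fst e \<noteq> snd e" if "e \<in> parcs (R_graph k s t)" for e
      using that assms unfolding E by (cases e) (auto simp: symcl_iff)
    have "(b, a) \<in> parcs (R_graph k s t)" if "(a, b) \<in> parcs (R_graph k s t)" for a b
      using that unfolding E Un_iff Diff_iff symcl_iff by blast
    then show "symmetric (with_proj (R_graph k s t))"
      unfolding symmetric_def by (simp add: sym_def)
  qed
  show "card (pverts (R_graph k s t)) = s + t + 2 * k - 1" by (simp add: V)
qed

lemma eigenvalue_adjacency_matrix_iff:
  assumes vs: "distinct vs" "set vs = pverts G"
  shows "eigenvalue (adjacency_matrix G vs) x \<longleftrightarrow>
    (\<exists>f. (\<exists>v\<in>pverts G. f v \<noteq> 0) \<and>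
      (\<forall>v\<in>pverts G. (\<Sum>w\<in>pverts G. (if (v, w) \<in> parcs G then 1 else 0) * f w) = x * f v))"
proof -
  let ?n = "length vs"
  let ?A = "adjacency_matrix G vs"
  have dim: "dim_row ?A = ?n" "?A \<in> carrier_mat ?n ?n"
    by (auto simp: adjacency_matrix_def)
  have bij: "bij_betw (\<lambda>i. vs ! i) {0..<?n} (pverts G)"
    using vs by (simp add: bij_betw_nth atLeast0LessThan)
  have row: "(?A *\<^sub>v vec ?n (\<lambda>i. f (vs ! i))) $ i =
      (\<Sum>w\<in>pverts G. (if (vs ! i, w) \<in> parcs G then 1 else 0) * f w)" if "i < ?n" for i f
    using that sum.reindex_bij_betw[OF bij,
        of "\<lambda>w. (if (vs ! i, w) \<in> parcs G then 1 else 0) * f w"]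
    by (simp add: adjacency_matrix_def scalar_prod_def)
  have vec_iff: "eigenvector ?A (vec ?n (\<lambda>i. f (vs ! i))) x \<longleftrightarrow>
     (\<exists>v\<in>pverts G. f v \<noteq> 0) \<and>
      (\<forall>v\<in>pverts G. (\<Sum>w\<in>pverts G. (if (v, w) \<in> parcs G then 1 else 0) * f w) = x * f v)" for f
  proof -
    have 1: "vec ?n (\<lambda>i. f (vs ! i)) \<noteq> 0\<^sub>v ?n \<longleftrightarrow> (\<exists>v\<in>pverts G. f v \<noteq> 0)"
      by (auto simp: vec_eq_iff vs(2)[symmetric] all_set_conv_all_nth Bex_def in_set_conv_nth)
    have 2: "?A *\<^sub>v vec ?n (\<lambda>i. f (vs ! i)) = x \<cdot>\<^sub>v vec ?n (\<lambda>i. f (vs ! i)) \<longleftrightarrow>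
        (\<forall>i<?n. (\<Sum>w\<in>pverts G. (if (vs ! i, w) \<in> parcs G then 1 else 0) * f w) = x * f (vs ! i))"
      using dim row[of _ f] by (subst vec_eq_iff) (auto simp del: index_mult_mat_vec)
    show ?thesis
      unfolding eigenvector_def dim(1) 1 2 
      by (simp add: vs(2)[symmetric] all_set_conv_all_nth)
  qed
  have all: "\<exists>f. v = vec ?n (\<lambda>i. f (vs ! i))" if "v \<in> carrier_vec ?n" for v :: "real vec"
  proof -
    have "v = vec ?n (\<lambda>i. v $ the_inv_into {0..<?n} (\<lambda>i. vs ! i) (vs ! i))"
      using that bij by (auto simp: vec_eq_iff bij_betw_def the_inv_into_f_f)
    then show ?thesis by (intro exI[of _ "\<lambda>w. v $ the_inv_into {0..<?n} (\<lambda>i. vs ! i) w"])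
  qed
  show ?thesis
    unfolding eigenvalue_def vec_iff[symmetric]
    using all by (metis dim(1) eigenvector_def)
qed

lemma eigenvalue_adjacency_matrix_enumeration:
  assumes "distinct vs" "set vs = pverts G" "distinct ws" "set ws = pverts G"
  shows "eigenvalue (adjacency_matrix G vs) x \<longleftrightarrow> eigenvalue (adjacency_matrix G ws) x"
  using assms by (simp add: eigenvalue_adjacency_matrix_iff)

lemma real_symmetric_eigenvalue_exists:
  fixes A :: "real mat"
  assumes A: "A \<in> carrier_mat n n" and n: "n > 0"
    and sym: "\<And>i j. i < n \<Longrightarrow> j < n \<Longrightarrow> A $$ (i, j) = A $$ (j, i)"
  shows "\<exists>x. eigenvalue A x"
proof -
  let ?B = "map_mat complex_of_real A"
  have B: "?B \<in> carrier_mat n n" using A by auto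
  from spectrum_non_empty[OF B n] obtain c where c: "eigenvalue ?B c"
    by (auto simp: spectrum_def)
  then obtain v where v: "v \<in> carrier_vec n" "v \<noteq> 0\<^sub>v n" "?B *\<^sub>v v = c \<cdot>\<^sub>v v"
    using A by (auto simp: eigenvalue_def eigenvector_def)
  have ev: "(\<Sum>j<n. of_real (A $$ (i, j)) * v $ j) = c * v $ i" if "i < n" for i
  proof -
    have "(?B *\<^sub>v v) $ i = (\<Sum>j<n. of_real (A $$ (i, j)) * v $ j)"
      using that A v(1) by (simp add: scalar_prod_def atLeast0LessThan)
    then show ?thesis using v(1,3) that by simp
  qed
  let ?N = "\<Sum>i<n. cnj (v $ i) * v $ i"
  let ?Q = "\<Sum>i<n. \<Sum>j<n. cnj (v $ i) * of_real (A $$ (i, j)) * v $ j"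
  have Q: "?Q = c * ?N"
  proof -
    have "?Q = (\<Sum>i<n. cnj (v $ i) * (\<Sum>j<n. of_real (A $$ (i, j)) * v $ j))"
      by (simp add: sum_distrib_left mult.assoc)
    also have "\<dots> = (\<Sum>i<n. cnj (v $ i) * (c * v $ i))"
      by (intro sum.cong refl) (simp add: ev)
    finally show ?thesis by (simp add: sum_distrib_left mult_ac)
  qed
  have "cnj ?Q = (\<Sum>i<n. \<Sum>j<n. cnj (v $ j) * of_real (A $$ (i, j)) * v $ i)"
    by (simp add: mult_ac)
  also have "\<dots> = (\<Sum>j<n. \<Sum>i<n. cnj (v $ j) * of_real (A $$ (i, j)) * v $ i)"
    by (rule sum.swap)
  also have "\<dots> = ?Q"
    by (intro sum.cong refl) (simp add: sym)
  finally have "cnj c * ?N = c * ?N"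
    unfolding Q by (simp add: mult_ac)
  moreover have "?N \<noteq> 0"
  proof -
    have N: "?N = of_real (\<Sum>i<n. (cmod (v $ i))\<^sup>2)"
      unfolding of_real_sum by (intro sum.cong refl) (metis complex_norm_square mult.commute)
    obtain i where "i < n" "v $ i \<noteq> 0" using v(1,2) by (auto simp: vec_eq_iff)
    then have "(\<Sum>i<n. (cmod (v $ i))\<^sup>2) > 0" by (intro sum_pos2[of _ i]) auto
    then show ?thesis unfolding N of_real_eq_0_iff by simp
  qed
  ultimately have "c \<in> \<real>" by (simp add: complex_is_Real_iff complex_eq_iff)
  then obtain x where x: "c = of_real x" by (auto elim: Reals_cases)
  have "poly (map_poly complex_of_real (char_poly A)) (of_real x) = 0"
    using c unfolding x eigenvalue_root_char_poly[OF B] of_real_hom.char_poly_hom[OF A] .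
  then have "poly (char_poly A) x = 0" by simp
  then show ?thesis using eigenvalue_root_char_poly[OF A] by blast
qed

lemma graph_eigenvalues_finite_nonempty:
  assumes "pair_graph G" "pverts G \<noteq> {}"
  shows "finite (graph_eigenvalues G)" "graph_eigenvalues G \<noteq> {}"
proof -
  interpret pair_graph G by fact
  obtain vs where vs: "distinct vs" "set vs = pverts G"
    using finite_distinct_list[OF pair_finite_verts] by blast
  let ?A = "adjacency_matrix G vs"
  have A: "?A \<in> carrier_mat (length vs) (length vs)" by (simp add: adjacency_matrix_def)
  have eq: "graph_eigenvalues G = spectrum ?A"
    using vs eigenvalue_adjacency_matrix_enumeration
    unfolding graph_eigenvalues_def spectrum_def by blast
  show "finite (graph_eigenvalues G)" unfolding eq using card_finite_spectrum[OF A] by simp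
  have "\<exists>x. eigenvalue ?A x"
  proof (rule real_symmetric_eigenvalue_exists[OF A])
    show "0 < length vs" using vs assms(2) by auto
    have "(u, w) \<in> parcs G \<longleftrightarrow> (w, u) \<in> parcs G" for u w
      using pair_sym_arcs by (auto simp: symmetric_def dest: symD)
    then show "?A $$ (i, j) = ?A $$ (j, i)" if "i < length vs" "j < length vs" for i j
      using that by (simp add: adjacency_matrix_def)
  qed
  then show "graph_eigenvalues G \<noteq> {}" unfolding eq spectrum_def by blast
qed

end

theory Submission
  imports Defs "HOL-Analysis.Analysis"
begin

text \<open>
  Fix the vertex set and let \<open>G\<close> have maximal \<open>\<lambda>\<^sub>1\<close> among the graphs without odd closed walks of length
  at most \<open>2k + 1\<close> that have some odd closed walk; let \<open>x \<ge> 0\<close> be a Perron vector. Take a shortest odd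
  cycle \<open>C\<close>, of length \<open>g \<ge> 2k + 3\<close>. Replacing a vertex \<open>u\<close> outside \<open>C\<close> by a clone of a non-neighbour
  \<open>v\<close> keeps \<open>G\<close> in the class (it folds back onto \<open>G\<close>) and changes the quadratic form by
  \<open>2 x\<^sub>u \<lambda>\<^sub>1 (x\<^sub>v - x\<^sub>u)\<close>. Hence \<open>x\<^sub>v \<le> x\<^sub>u\<close>, with equality only for twins. So the vertices outside \<open>C\<close> form
  at most two classes of twins, completely joined to each other, and minimality of \<open>C\<close> makes \<open>G\<close> a
  subgraph of a blow-up of \<open>C\<close> at two consecutive vertices. That blow-up is in the class too, so it
  equals \<open>G\<close>. If \<open>g > 2k + 3\<close>, moving two adjacent cycle vertices into one of the blown-up classes
  increases the quadratic form. If the two class sizes differ by at least 2, moving one vertex from the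
  larger class to the smaller one increases \<open>\<lambda>\<^sub>1\<close>; the test vector combines \<open>x\<close> with its reflection.
  What remains is \<open>R\<^sub>k(K\<^sub>s\<^sub>,\<^sub>t)\<close> with \<open>s\<close>, \<open>t\<close> balanced.
\<close>

section \<open>Rayleigh quotients and Perron vectors\<close>

text \<open>Excluding odd closed walks instead of odd cycles makes the class easy to stay in: a
  graph with a homomorphism to a graph without odd closed walks of length at most
  \<open>2 * k + 1\<close> has none either. Clones and blow-ups are thus controlled by a map to
  \<open>E\<close> or to \<open>C\<^sub>g\<close>, and their cycles never have to be traced. The
  obstacle is that the graphs need not be connected, so a Perron vector is at first only
  non-negative, and a modification may leave the form unchanged. Maximality then makes the same
  vector a Perron vector of the modified graph, and comparing the eigen-equations of the two graphs
  at one vertex supplies what positivity would. Positivity on the cycle is known only once the graph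
  lies in a blow-up.\<close>

definition graph_on :: "'a set \<Rightarrow> ('a \<times> 'a) set \<Rightarrow> bool" where
  "graph_on V E \<longleftrightarrow> finite V \<and> V \<noteq> {} \<and> E \<subseteq> V \<times> V \<and> sym E \<and> irrefl E"

text \<open>For symmetric \<open>E\<close> this is \<open>x\<^sup>T A x\<close> with the adjacency
  matrix \<open>A\<close>. Both arcs of an edge are summed, which is the origin of the factors 2 in
  all formulas for local changes.\<close>

definition qform :: "('a \<times> 'a) set \<Rightarrow> ('a \<Rightarrow> real) \<Rightarrow> real" where
  "qform E x = (\<Sum>(u, v)\<in>E. x u * x v)"

definition sqnorm :: "'a set \<Rightarrow> ('a \<Rightarrow> real) \<Rightarrow> real" where
  "sqnorm V x = (\<Sum>v\<in>V. (x v)\<^sup>2)"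

abbreviation lam :: "'a set \<Rightarrow> ('a \<times> 'a) set \<Rightarrow> real" where
  "lam V E \<equiv> lambda1 \<lparr>pverts = V, parcs = E\<rparr>"

lemma graph_onD:
  assumes "graph_on V E"
  shows "finite V" "V \<noteq> {}" "E \<subseteq> V \<times> V" "finite E" "sym E" "irrefl E"
    "(u, v) \<in> E \<Longrightarrow> (v, u) \<in> E" "(u, u) \<notin> E" "(u, v) \<in> E \<Longrightarrow> u \<in> V \<and> v \<in> V"
    "finite (E `` A)" "E `` A \<subseteq> V"
proof -
  show "finite V" "V \<noteq> {}" "E \<subseteq> V \<times> V" "sym E" "irrefl E"
    using assms by (auto simp: graph_on_def)
  then show "finite E" "(u, v) \<in> E \<Longrightarrow> (v, u) \<in> E" "(u, u) \<notin> E" "(u, v) \<in> E \<Longrightarrow> u \<in> V \<and> v \<in> V"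
     "E `` A \<subseteq> V"
    by (auto simp: irrefl_def dest: symD intro: finite_subset)
  show "finite (E `` A)" using \<open>E `` A \<subseteq> V\<close> \<open>finite V\<close> finite_subset by blast
qed

lemma pair_graph_iff_graph_on:
  assumes "V \<noteq> {}"
  shows "pair_graph \<lparr>pverts = V, parcs = E\<rparr> \<longleftrightarrow> graph_on V E"
proof
  assume "pair_graph \<lparr>pverts = V, parcs = E\<rparr>"
  then interpret pair_graph "\<lparr>pverts = V, parcs = E\<rparr>" .
  show "graph_on V E"
    unfolding graph_on_def irrefl_def
    using assms pair_finite_verts arc_fst_in_verts arc_snd_in_verts pair_no_loops pair_sym_arcs
    by (fastforce simp: symmetric_def)
next
  assume "graph_on V E"
  note D = graph_onD[OF this]
  show "pair_graph \<lparr>pverts = V, parcs = E\<rparr>"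
    by unfold_locales (use D in \<open>auto simp: symmetric_def\<close>)
qed

lemma sum_arcs_eq:
  assumes "graph_on V E"
  shows "(\<Sum>(u, v)\<in>E. f u v) = (\<Sum>u\<in>V. \<Sum>v\<in>E `` {u}. f u v)"
proof -
  have "E = Sigma V (\<lambda>u. E `` {u})" using graph_onD(3)[OF assms] by auto
  moreover have "(\<Sum>(u, v)\<in>Sigma V (\<lambda>u. E `` {u}). f u v) = (\<Sum>u\<in>V. \<Sum>v\<in>E `` {u}. f u v)"
    using graph_onD(1,10)[OF assms] by (subst sum.Sigma) auto
  ultimately show ?thesis by simp
qed

lemma qform_eq_sum_neighbours:
  assumes "graph_on V E"
  shows "qform E x = (\<Sum>u\<in>V. x u * sum x (E `` {u}))"
  unfolding qform_def sum_arcs_eq[OF assms] by (simp add: sum_distrib_left)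

lemma qform_add_indicator:
  assumes "graph_on V E" "v \<in> V"
  shows "qform E (\<lambda>w. x w + (if w = v then t else 0)) = qform E x + 2 * t * sum x (E `` {v})"
proof -
  note D = graph_onD[OF assms(1)]
  let ?d = "\<lambda>w. if w = v then t else (0::real)"
  have 1: "(\<Sum>(u, w)\<in>E. ?d u * x w) = t * sum x (E `` {v})"
  proof -
    have "(\<Sum>u\<in>V. \<Sum>w\<in>E `` {u}. ?d u * x w) =
        (\<Sum>u\<in>V. if u = v then t * sum x (E `` {v}) else 0)"
      by (rule sum.cong) (auto simp: sum_distrib_left)
    then show ?thesis unfolding sum_arcs_eq[OF assms(1)] using D(1) assms(2) by simp
  qed
  have 2: "(\<Sum>(u, w)\<in>E. x u * ?d w) = (\<Sum>(u, w)\<in>E. ?d u * x w)"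
    by (rule sum.reindex_bij_witness[of _ prod.swap prod.swap]) (auto dest: D(7))
  have 3: "(\<Sum>(u, w)\<in>E. ?d u * ?d w) = 0"
    using D(8) by (intro sum.neutral) auto
  have "qform E (\<lambda>w. x w + ?d w) =
     (\<Sum>(u, w)\<in>E. x u * x w) + (\<Sum>(u, w)\<in>E. x u * ?d w) + (\<Sum>(u, w)\<in>E. ?d u * x w) +
     (\<Sum>(u, w)\<in>E. ?d u * ?d w)"
    unfolding qform_def sum.distrib[symmetric] by (rule sum.cong) (auto simp: algebra_simps)
  then show ?thesis unfolding 2 1 3 qform_def by simp
qed

lemma sqnorm_add_indicator:
  assumes "finite V" "v \<in> V"
  shows "sqnorm V (\<lambda>w. x w + (if w = v then t else 0)) = sqnorm V x + 2 * t * x v + t\<^sup>2"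
proof -
  have "sqnorm V (\<lambda>w. x w + (if w = v then t else 0)) =
     (\<Sum>w\<in>V. (x w)\<^sup>2 + (if w = v then 2 * t * x w + t\<^sup>2 else 0))"
    unfolding sqnorm_def by (rule sum.cong) (auto simp: power2_eq_square algebra_simps)
  then show ?thesis using assms by (simp add: sum.distrib sqnorm_def)
qed

lemma linear_coefficient_zero:
  fixes c m :: real
  assumes "\<And>t. 2 * t * c + t\<^sup>2 * m \<ge> 0"
  shows "c = 0"
proof (rule ccontr)
  assume "c \<noteq> 0"
  \<comment> \<open>At \<open>t = - c / M\<close> the polynomial is at most
    \<open>- c\<^sup>2 / M\<close>; the summand 1 keeps \<open>M\<close> positive if
    \<open>m\<close> is 0.\<close>
  define M where "M = \<bar>m\<bar> + 1"
  have M: "M > 0" "m \<le> M" by (auto simp: M_def)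
  have "0 \<le> 2 * (- c / M) * c + (- c / M)\<^sup>2 * m" by (rule assms)
  also have "(- c / M)\<^sup>2 * m \<le> (- c / M)\<^sup>2 * M" using M by (intro mult_left_mono) auto
  also have "2 * (- c / M) * c + (- c / M)\<^sup>2 * M = - (c\<^sup>2 / M)"
    using M by (simp add: field_simps power2_eq_square)
  finally show False using M \<open>c \<noteq> 0\<close> by (simp add: divide_le_0_iff)
qed

text \<open>A maximiser of the Rayleigh quotient is a critical point: varying the coordinate
  \<open>v\<close> by \<open>t\<close> gives a non-negative polynomial in \<open>t\<close> without
  constant term, whose linear coefficient is the defect of the eigen-equation at
  \<open>v\<close>.\<close>

lemma rayleigh_equality_imp_eigen:
  assumes G: "graph_on V E" and le: "\<And>y. qform E y \<le> \<mu> * sqnorm V y"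
    and eq: "qform E x = \<mu> * sqnorm V x" and v: "v \<in> V"
  shows "sum x (E `` {v}) = \<mu> * x v"
proof -
  have "2 * t * (\<mu> * x v - sum x (E `` {v})) + t\<^sup>2 * \<mu> \<ge> 0" for t
    using le[of "\<lambda>w. x w + (if w = v then t else 0)"] eq
    unfolding qform_add_indicator[OF G v] sqnorm_add_indicator[OF graph_onD(1)[OF G] v]
    by (simp add: algebra_simps)
  from linear_coefficient_zero[OF this] show ?thesis by simp
qed

lemma qform_cong:
  assumes "E \<subseteq> V \<times> V" "\<And>v. v \<in> V \<Longrightarrow> x v = y v"
  shows "qform E x = qform E y"
  unfolding qform_def by (rule sum.cong) (use assms in auto)

lemma sqnorm_cong: "(\<And>v. v \<in> V \<Longrightarrow> x v = y v) \<Longrightarrow> sqnorm V x = sqnorm V y"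
  unfolding sqnorm_def by (rule sum.cong) auto

lemma sqnorm_nonneg: "sqnorm V x \<ge> 0"
  unfolding sqnorm_def by (rule sum_nonneg) auto

lemma sqnorm_pos:
  assumes "finite V" "v \<in> V" "x v \<noteq> 0"
  shows "sqnorm V x > 0"
  unfolding sqnorm_def by (rule sum_pos2[of _ v]) (use assms in auto)

lemma qform_scale: "qform E (\<lambda>v. c * x v) = c\<^sup>2 * qform E x"
  unfolding qform_def sum_distrib_left by (rule sum.cong) (auto simp: power2_eq_square)

lemma sqnorm_scale: "sqnorm V (\<lambda>v. c * x v) = c\<^sup>2 * sqnorm V x"
  unfolding sqnorm_def sum_distrib_left by (rule sum.cong) (auto simp: power_mult_distrib)

lemma unit_maximizer_exists:
  assumes G: "graph_on V E"
  shows "\<exists>x. sqnorm V x = 1 \<and> (\<forall>y. sqnorm V y = 1 \<longrightarrow> qform E y \<le> qform E x)"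
proof -
  note D = graph_onD[OF G]
  \<comment> \<open>Coordinates outside \<open>V\<close> are pinned to 0, so that the box is compact
    in the space of all functions, by Tychonoff; the form does not see these coordinates.\<close>
  define B where "B = (\<lambda>i. if i \<in> V then {-1..1} else {0::real})"
  define K where "K = Pi\<^sub>E UNIV B \<inter> {x. sqnorm V x = 1}"
  have "compact (Pi\<^sub>E UNIV B)"
    using compactin_PiE[of "\<lambda>_. euclideanreal" UNIV B]
    by (simp add: euclidean_product_topology B_def)
  moreover have "closed {x. sqnorm V x = 1}"
    unfolding sqnorm_def by (intro closed_Collect_eq continuous_intros) auto
  ultimately have K: "compact K" unfolding K_def by (rule compact_Int_closed)
  obtain v where v: "v \<in> V" using D(2) by auto
  have "(\<lambda>w. if w = v then 1 else 0) \<in> K"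
    using v D(1) by (auto simp: K_def B_def sqnorm_def if_distrib[of "\<lambda>a. a\<^sup>2"] cong: if_cong)
  moreover have "continuous_on K (qform E)"
    unfolding qform_def[abs_def] split_def
    by (intro continuous_intros continuous_on_subset[OF continuous_on_product_coordinates]) auto
  ultimately obtain x where x: "x \<in> K" "\<And>y. y \<in> K \<Longrightarrow> qform E y \<le> qform E x"
    using continuous_attains_sup[OF K] by blast
  have "qform E y \<le> qform E x" if y: "sqnorm V y = 1" for y
  proof -
    define z where "z = (\<lambda>v. if v \<in> V then y v else 0)"
    have "\<bar>y w\<bar> \<le> 1" if "w \<in> V" for w
    proof -
      have "(y w)\<^sup>2 \<le> sqnorm V y"
        unfolding sqnorm_def by (rule member_le_sum) (use that D(1) in auto)
      then show ?thesis using y by (simp add: abs_square_le_1)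
    qed
    then have "z \<in> Pi\<^sub>E UNIV B" by (auto simp: z_def B_def abs_le_iff minus_le_iff)
    moreover have "sqnorm V z = sqnorm V y" "qform E z = qform E y"
      by (auto simp: z_def intro!: sqnorm_cong qform_cong[OF D(3)])
    ultimately show ?thesis using x(2)[of z] y by (simp add: K_def)
  qed
  then show ?thesis using x(1) by (auto simp: K_def)
qed

lemma graph_eigenvalues_iff:
  assumes "graph_on V E"
  shows "\<theta> \<in> graph_eigenvalues \<lparr>pverts = V, parcs = E\<rparr> \<longleftrightarrow>
    (\<exists>f. (\<exists>v\<in>V. f v \<noteq> 0) \<and> (\<forall>v\<in>V. sum f (E `` {v}) = \<theta> * f v))"
proof -
  note D = graph_onD[OF assms]
  have eq: "(\<Sum>w\<in>V. (if (v, w) \<in> E then 1 else 0) * f w) = sum f (E `` {v})" for v and f :: "'a \<Rightarrow> real"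
  proof -
    have "(\<Sum>w\<in>V. (if (v, w) \<in> E then 1 else 0) * f w) = (\<Sum>w\<in>V. if w \<in> E `` {v} then f w else 0)"
      by (rule sum.cong) auto
    also have "\<dots> = sum f (V \<inter> E `` {v})" using D(1) by (simp add: sum.inter_restrict)
    also have "V \<inter> E `` {v} = E `` {v}" using D(11) by blast
    finally show ?thesis .
  qed
  obtain vs where vs: "distinct vs" "set vs = V" using finite_distinct_list[OF D(1)] by blast
  have "\<theta> \<in> graph_eigenvalues \<lparr>pverts = V, parcs = E\<rparr> \<longleftrightarrow>
    (\<exists>vs. distinct vs \<and> set vs = V \<and>
       (\<exists>f. (\<exists>v\<in>V. f v \<noteq> 0) \<and> (\<forall>v\<in>V. sum f (E `` {v}) = \<theta> * f v)))"
    unfolding graph_eigenvalues_def mem_Collect_eq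
    by (rule ex_cong1, simp, rule conj_cong, rule refl, rule conj_cong, rule refl,
        subst eigenvalue_adjacency_matrix_iff) (auto simp: eq)
  then show ?thesis using vs by blast
qed

lemma qform_eigen:
  assumes "graph_on V E" "\<And>v. v \<in> V \<Longrightarrow> sum x (E `` {v}) = \<theta> * x v"
  shows "qform E x = \<theta> * sqnorm V x"
proof -
  have "qform E x = (\<Sum>v\<in>V. \<theta> * (x v)\<^sup>2)"
    unfolding qform_eq_sum_neighbours[OF assms(1)]
    by (rule sum.cong) (simp_all add: assms(2) power2_eq_square)
  then show ?thesis by (simp add: sqnorm_def sum_distrib_left)
qed

text \<open>The maximum of the form on the unit sphere is an eigenvalue by criticality, and it
  bounds every eigenvalue, because an eigenvector of \<open>\<theta>\<close> has Rayleigh quotient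
  \<open>\<theta>\<close>.\<close>

lemma lam_rayleigh:
  assumes G: "graph_on V E"
  shows "qform E y \<le> lam V E * sqnorm V y"
    and "\<exists>x. sqnorm V x = 1 \<and> qform E x = lam V E"
proof -
  note D = graph_onD[OF G]
  obtain x where x: "sqnorm V x = 1" "\<And>y. sqnorm V y = 1 \<Longrightarrow> qform E y \<le> qform E x"
    using unit_maximizer_exists[OF G] by blast
  define \<mu> where "\<mu> = qform E x"
  have le: "qform E y \<le> \<mu> * sqnorm V y" for y
  proof (cases "sqnorm V y = 0")
    case True
    then have "\<forall>v\<in>V. y v = 0" using sqnorm_pos[OF D(1)] by (metis less_irrefl)
    then have "qform E y = qform E (\<lambda>v. 0)" by (intro qform_cong[OF D(3)]) auto
    then show ?thesis using True by (simp add: qform_def)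
  next
    case False
    then have pos: "sqnorm V y > 0" using sqnorm_nonneg[of V y] by linarith
    define c where "c = 1 / sqrt (sqnorm V y)"
    have c: "c\<^sup>2 = 1 / sqnorm V y" using pos by (simp add: c_def power_divide)
    have "sqnorm V (\<lambda>v. c * y v) = 1" using pos by (simp add: sqnorm_scale c)
    from x(2)[OF this] show ?thesis using pos by (simp add: qform_scale c \<mu>_def field_simps)
  qed
  have "\<mu> \<in> graph_eigenvalues \<lparr>pverts = V, parcs = E\<rparr>"
  proof -
    have "\<exists>v\<in>V. x v \<noteq> 0" using x(1) by (auto simp: sqnorm_def intro: ccontr)
    moreover have "\<forall>v\<in>V. sum x (E `` {v}) = \<mu> * x v"
      using rayleigh_equality_imp_eigen[OF G le, of x] x(1) by (simp add: \<mu>_def)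
    ultimately show ?thesis unfolding graph_eigenvalues_iff[OF G] by blast
  qed
  moreover have "\<theta> \<le> \<mu>" if "\<theta> \<in> graph_eigenvalues \<lparr>pverts = V, parcs = E\<rparr>" for \<theta>
  proof -
    from that obtain f v where f: "v \<in> V" "f v \<noteq> 0" "\<And>v. v \<in> V \<Longrightarrow> sum f (E `` {v}) = \<theta> * f v"
      unfolding graph_eigenvalues_iff[OF G] by blast
    have "\<theta> * sqnorm V f \<le> \<mu> * sqnorm V f" using qform_eigen[OF G f(3)] le[of f] by simp
    then show ?thesis using sqnorm_pos[of V v f] D(1) f(1,2) by simp
  qed
  moreover have "finite (graph_eigenvalues \<lparr>pverts = V, parcs = E\<rparr>)"
    using graph_eigenvalues_finite_nonempty(1)[of "\<lparr>pverts = V, parcs = E\<rparr>"] G D(2)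
    by (simp add: pair_graph_iff_graph_on)
  ultimately have "lam V E = \<mu>" unfolding lambda1_def by (intro Max_eqI) auto
  then show "qform E y \<le> lam V E * sqnorm V y" "\<exists>x. sqnorm V x = 1 \<and> qform E x = lam V E"
    using le x(1) by (auto simp: \<mu>_def)
qed

text \<open>Only one entry must be positive, since a disconnected graph may have no positive
  eigenvector for its largest eigenvalue.\<close>

definition perron :: "'a set \<Rightarrow> ('a \<times> 'a) set \<Rightarrow> ('a \<Rightarrow> real) \<Rightarrow> bool" where
  "perron V E x \<longleftrightarrow> (\<forall>v\<in>V. x v \<ge> 0) \<and> (\<exists>v\<in>V. x v > 0) \<and>
     (\<forall>v\<in>V. sum x (E `` {v}) = lam V E * x v)"

lemma perron_iff_rayleigh:
  assumes "graph_on V E"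
  shows "perron V E x \<longleftrightarrow> (\<forall>v\<in>V. x v \<ge> 0) \<and> (\<exists>v\<in>V. x v > 0) \<and> qform E x = lam V E * sqnorm V x"
  unfolding perron_def
  using qform_eigen[OF assms] rayleigh_equality_imp_eigen[OF assms lam_rayleigh(1)[OF assms]]
  by blast

lemma perron_exists:
  assumes G: "graph_on V E"
  shows "\<exists>x. perron V E x"
proof -
  note D = graph_onD[OF G]
  obtain x where x: "sqnorm V x = 1" "qform E x = lam V E" using lam_rayleigh(2)[OF G] by blast
  let ?y = "\<lambda>v. \<bar>x v\<bar>"
  have n: "sqnorm V ?y = 1" using x(1) by (simp add: sqnorm_def)
  have "qform E x \<le> qform E ?y"
    unfolding qform_def by (rule sum_mono) (auto simp: abs_mult[symmetric])
  then have "qform E ?y = lam V E" using lam_rayleigh(1)[OF G, of ?y] n x(2) by simp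
  moreover have "\<exists>v\<in>V. x v \<noteq> 0" using x(1) by (auto simp: sqnorm_def intro: ccontr)
  ultimately have "perron V E ?y" unfolding perron_iff_rayleigh[OF G] n by auto
  then show ?thesis by blast
qed

section \<open>Odd closed walks\<close>

lemma relpow_sym:
  assumes "sym E" "(a, b) \<in> E ^^ l"
  shows "(b, a) \<in> E ^^ l"
  using assms(2)
proof (induction l arbitrary: b)
  case (Suc l)
  then obtain c where c: "(a, c) \<in> E ^^ l" "(c, b) \<in> E" by auto
  then have "(b, c) \<in> E" using assms(1) by (blast dest: symD)
  then show ?case using Suc.IH[OF c(1)] by (rule relpow_Suc_I2)
qed auto

lemma relpow_hom:
  assumes "\<And>a b. (a, b) \<in> E' \<Longrightarrow> (\<phi> a, \<phi> b) \<in> E" "(a, b) \<in> E' ^^ l"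
  shows "(\<phi> a, \<phi> b) \<in> E ^^ l"
  using assms(2) by (induction l arbitrary: b) (auto intro: assms(1))

lemma relpow_int_sequence:
  fixes h :: "int \<Rightarrow> 'a"
  assumes "\<And>i. (h i, h (i + 1)) \<in> R"
  shows "(h i, h (i + int m)) \<in> R ^^ m"
proof (induction m)
  case (Suc m)
  moreover have "i + int (Suc m) = (i + int m) + 1" by simp
  ultimately show ?case using assms[of "i + int m"] by (metis relpow_Suc_I)
qed simp

text \<open>Closed walks of length \<open>l\<close> are the diagonal pairs of \<open>E ^^ l\<close>.
  The last clause stands for non-bipartiteness.\<close>

definition admissible :: "nat \<Rightarrow> 'a set \<Rightarrow> ('a \<times> 'a) set \<Rightarrow> bool" where
  "admissible k V E \<longleftrightarrow> graph_on V E \<and> (\<forall>l a. odd l \<and> l \<le> 2 * k + 1 \<longrightarrow> (a, a) \<notin> E ^^ l) \<and>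
     (\<exists>l a. odd l \<and> (a, a) \<in> E ^^ l)"

text \<open>Indexing by all integers avoids wrap-around: positions can be shifted freely, and on a
  shortest odd walk equality of vertices becomes divisibility by \<open>g\<close>.\<close>

lemma closed_walk_periodic:
  assumes "(a, a) \<in> E ^^ g" "g > 0"
  shows "\<exists>f :: int \<Rightarrow> 'a. (\<forall>i. (f i, f (i + 1)) \<in> E) \<and> (\<forall>i. f (i + int g) = f i)"
proof -
  obtain h where h: "h 0 = a" "h g = a" "\<And>i. i < g \<Longrightarrow> (h i, h (Suc i)) \<in> E"
    using assms(1) unfolding relpow_fun_conv by blast
  define f where "f i = h (nat (i mod int g))" for i
  have "(f i, f (i + 1)) \<in> E" for i
  proof -
    define m where "m = nat (i mod int g)"
    have m: "m < g" "i mod int g = int m" using assms(2) by (auto simp: m_def nat_less_iff)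
    have "(i + 1) mod int g = (int m + 1) mod int g" by (metis m(2) mod_add_left_eq)
    also have "\<dots> = int (Suc m mod g)" by (simp add: of_nat_mod add.commute)
    finally have "f (i + 1) = h (Suc m mod g)" unfolding f_def by simp
    moreover have "h (Suc m mod g) = h (Suc m)"
      using m(1) h(1,2) by (cases "Suc m = g") auto
    ultimately show ?thesis using h(3)[OF m(1)] by (simp add: f_def m_def)
  qed
  moreover have "f (i + int g) = f i" for i by (simp add: f_def)
  ultimately show ?thesis by blast
qed

definition extremal :: "nat \<Rightarrow> 'a set \<Rightarrow> ('a \<times> 'a) set \<Rightarrow> bool" where
  "extremal k V E \<longleftrightarrow> admissible k V E \<and> (\<forall>E'. admissible k V E' \<longrightarrow> lam V E' \<le> lam V E)"

lemma extremal_graph_on: "extremal k V E \<Longrightarrow> graph_on V E"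
  by (simp add: extremal_def admissible_def)

text \<open>The principle behind most modifications: \<open>x\<close> attains
  \<open>lam V E\<close>, so a competitor whose form at \<open>x\<close> is not smaller must attain
  the same value there. In particular a strictly larger form is impossible.\<close>

lemma extremal_perron_transfer:
  assumes "extremal k V E" "perron V E x" "admissible k V E'" "qform E' x \<ge> qform E x"
  shows "lam V E' = lam V E" "perron V E' x" "qform E' x = qform E x"
proof -
  have G: "graph_on V E" and G': "graph_on V E'" using assms by (auto simp: extremal_def admissible_def)
  have x: "\<forall>v\<in>V. x v \<ge> 0" "\<exists>v\<in>V. x v > 0" "qform E x = lam V E * sqnorm V x"
    using assms(2) unfolding perron_iff_rayleigh[OF G] by auto
  have le: "lam V E' \<le> lam V E" using assms(1,3) by (simp add: extremal_def)
  have pos: "sqnorm V x > 0" using x(2) sqnorm_pos graph_onD(1)[OF G] by (metis less_irrefl)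
  have "lam V E * sqnorm V x \<le> lam V E' * sqnorm V x"
    using lam_rayleigh(1)[OF G', of x] x(3) assms(4) by linarith
  then show *: "lam V E' = lam V E" using pos le by simp
  have q: "qform E' x = lam V E' * sqnorm V x"
    using lam_rayleigh(1)[OF G', of x] x(3) assms(4) * by simp
  then show "perron V E' x" unfolding perron_iff_rayleigh[OF G'] using x by blast
  show "qform E' x = qform E x" using q x(3) * by simp
qed

text \<open>For non-adjacent \<open>u\<close>, \<open>v\<close>, folding \<open>u\<close> onto \<open>v\<close> is a homomorphism back to \<open>E\<close>.\<close>

definition clone :: "('a \<times> 'a) set \<Rightarrow> 'a \<Rightarrow> 'a \<Rightarrow> ('a \<times> 'a) set" where
  "clone E u v = {(a, b) \<in> E. a \<noteq> u \<and> b \<noteq> u} \<union> {u} \<times> E `` {v} \<union> E `` {v} \<times> {u}"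

lemma qform_add_star:
  assumes "finite R" "finite N" "u \<notin> N" "\<And>a. (u, a) \<notin> R" "\<And>a. (a, u) \<notin> R"
  shows "qform (R \<union> {u} \<times> N \<union> N \<times> {u}) x = qform R x + 2 * x u * sum x N"
proof -
  have 1: "qform ({u} \<times> N) x = x u * sum x N"
    unfolding qform_def by (subst sum.cartesian_product[symmetric]) (simp add: sum_distrib_left)
  have 2: "qform (N \<times> {u}) x = x u * sum x N"
    unfolding qform_def
    by (subst sum.cartesian_product[symmetric]) (simp add: sum_distrib_left mult.commute)
  have "qform (R \<union> {u} \<times> N \<union> N \<times> {u}) x = qform R x + qform ({u} \<times> N) x + qform (N \<times> {u}) x"
    unfolding qform_def using assms by (subst sum.union_disjoint; auto)+
  then show ?thesis unfolding 1 2 by simp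
qed

lemma qform_remove_vertex:
  assumes "graph_on V E"
  shows "qform E x = qform {(a, b) \<in> E. a \<noteq> u \<and> b \<noteq> u} x + 2 * x u * sum x (E `` {u})"
proof -
  note D = graph_onD[OF assms]
  have "E = {(a, b) \<in> E. a \<noteq> u \<and> b \<noteq> u} \<union> {u} \<times> E `` {u} \<union> E `` {u} \<times> {u}"
    using D(7) by auto
  also have "qform \<dots> x = qform {(a, b) \<in> E. a \<noteq> u \<and> b \<noteq> u} x + 2 * x u * sum x (E `` {u})"
    using D(8,10) by (intro qform_add_star) (auto intro: finite_subset[OF _ D(4)])
  finally show ?thesis .
qed

lemma graph_on_clone:
  assumes "graph_on V E" "u \<in> V" "(u, v) \<notin> E"
  shows "graph_on V (clone E u v)"
proof -
  note D = graph_onD[OF assms(1)]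
  have "clone E u v \<subseteq> V \<times> V" using D(3) assms(2) unfolding clone_def by blast
  moreover have "sym (clone E u v)" using D(5) unfolding clone_def sym_def by blast
  moreover have "irrefl (clone E u v)" using D(7,8) assms(3) unfolding clone_def irrefl_def by blast
  ultimately show ?thesis using D(1,2) by (simp add: graph_on_def)
qed

lemma qform_clone:
  assumes "graph_on V E" "(u, v) \<notin> E"
  shows "qform (clone E u v) x = qform E x + 2 * x u * (sum x (E `` {v}) - sum x (E `` {u}))"
proof -
  note D = graph_onD[OF assms(1)]
  have "qform (clone E u v) x = qform {(a, b) \<in> E. a \<noteq> u \<and> b \<noteq> u} x + 2 * x u * sum x (E `` {v})"
    unfolding clone_def using assms(2) D(7,10)
    by (intro qform_add_star) (auto intro: finite_subset[OF _ D(4)])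
  then show ?thesis using qform_remove_vertex[OF assms(1), of x u] by (simp add: algebra_simps)
qed

lemma clone_image:
  assumes "graph_on V E" "(u, v) \<notin> E"
  shows "clone E u v `` {u} = E `` {v}"
    "w \<noteq> u \<Longrightarrow> clone E u v `` {w} = (E `` {w} - {u}) \<union> (if (w, v) \<in> E then {u} else {})"
proof -
  have s: "(a, b) \<in> E \<Longrightarrow> (b, a) \<in> E" for a b by (rule graph_onD(7)[OF assms(1)])
  show "clone E u v `` {u} = E `` {v}"
    using s assms(2) unfolding clone_def by blast
  show "clone E u v `` {w} = (E `` {w} - {u}) \<union> (if (w, v) \<in> E then {u} else {})" if "w \<noteq> u"
  proof (cases "(w, v) \<in> E")
    case True
    then have "clone E u v `` {w} = (E `` {w} - {u}) \<union> {u}"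
      using s that unfolding clone_def by blast
    then show ?thesis using True by simp
  next
    case False
    then have "clone E u v `` {w} = E `` {w} - {u}"
      using s that unfolding clone_def by blast
    then show ?thesis using False by simp
  qed
qed

lemma relpow_clone:
  assumes "graph_on V E" "(u, v) \<notin> E" "v \<noteq> u" "(a, b) \<in> clone E u v ^^ l"
  shows "((id(u := v)) a, (id(u := v)) b) \<in> E ^^ l"
proof (rule relpow_hom[OF _ assms(4)])
  fix a b assume "(a, b) \<in> clone E u v"
  then consider "(a, b) \<in> E" "a \<noteq> u" "b \<noteq> u" | "a = u" "(v, b) \<in> E" | "b = u" "(v, a) \<in> E"
    by (auto simp: clone_def)
  then show "((id(u := v)) a, (id(u := v)) b) \<in> E"
  proof cases
    case 2
    then have "b \<noteq> u" using assms(2) graph_onD(7)[OF assms(1)] by blast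
    then show ?thesis using 2 by simp
  next
    case 3
    then have "a \<noteq> u" using assms(2) graph_onD(7)[OF assms(1)] by blast
    then show ?thesis using 3 graph_onD(7)[OF assms(1)] by simp
  qed simp
qed

section \<open>Shortest odd closed walks are isometric cycles\<close>

locale shortest_odd_walk =
  fixes V :: "'a set" and E :: "('a \<times> 'a) set" and g :: nat and f :: "int \<Rightarrow> 'a"
  assumes G: "graph_on V E" and odd_g: "odd g"
    and step: "(f i, f (i + 1)) \<in> E" and period: "f (i + int g) = f i"
    and shortest: "odd l \<Longrightarrow> l < g \<Longrightarrow> (a, a) \<notin> E ^^ l"
begin

lemmas GD = graph_onD[OF G]

lemma f_in_V: "f i \<in> V"
  using step GD(9) by blast

lemma f_cong:
  assumes "int g dvd i - j"
  shows "f i = f j"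
proof -
  have p: "f (i + int g * int m) = f i" for i m
  proof (induction m)
    case (Suc m)
    have "f (i + int g * int (Suc m)) = f ((i + int g * int m) + int g)" by (simp add: algebra_simps)
    then show ?case using Suc period by simp
  qed simp
  obtain c where c: "i - j = int g * c" using assms by (elim dvdE)
  show ?thesis
  proof (cases "c \<ge> 0")
    case True
    then have "i = j + int g * int (nat c)" using c by simp
    then show ?thesis by (simp only: p)
  next
    case False
    then have "j = i + int g * int (nat (- c))" using c by simp
    then show ?thesis by (simp only: p)
  qed
qed

lemma path: "(f i, f (i + int m)) \<in> E ^^ m"
  by (rule relpow_int_sequence) (rule step)

text \<open>A walk between two vertices of the cycle has the same length modulo 2 as one along the cycle
  that is at most as long, since otherwise it closes up to a shorter odd closed walk.\<close>

lemma detour: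
  assumes "(f i, f j) \<in> E ^^ m"
  shows "\<exists>r. \<bar>r\<bar> \<le> int m \<and> even (r + int m) \<and> int g dvd j - i - r"
proof -
  define d where "d = nat ((j - i) mod int g)"
  have d: "d < g" "int d = (j - i) mod int g"
    using odd_pos[OF odd_g] by (auto simp: d_def nat_less_iff)
  then have dvd: "int g dvd j - i - int d" by (simp add: mod_eq_dvd_iff)
  then have fj: "f j = f (i + int d)" by (intro f_cong) (simp add: algebra_simps)
  \<comment> \<open>\<open>d\<close> is the length of the forward arc from \<open>f i\<close> to
    \<open>f j\<close>. If \<open>m\<close> has the parity of \<open>d\<close>, closing with the
    other arc, of length \<open>g - d\<close>, gives \<open>m \<ge> d\<close> and
    \<open>r = d\<close>. Otherwise closing with the forward arc gives \<open>m \<ge> g - d\<close>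
    and \<open>r = d - g\<close>.\<close>
  show ?thesis
  proof (cases "even (d + m)")
    case True
    have "(f j, f (j + int (g - d))) \<in> E ^^ (g - d)" by (rule path)
    moreover have "f (j + int (g - d)) = f i"
    proof (rule f_cong)
      have "j + int (g - d) - i = (j - i - int d) + int g * 1" using d(1) by simp
      then show "int g dvd j + int (g - d) - i" using dvd by (simp only: dvd_add_times_triv_right_iff dvd_add dvd_triv_left)
    qed
    ultimately have "(f i, f i) \<in> E ^^ (m + (g - d))"
      using assms by (auto simp: relpow_add)
    moreover have "odd (m + (g - d))" using True odd_g d(1) by auto
    ultimately have "m + (g - d) \<ge> g" using shortest by (meson not_le)
    then show ?thesis using True dvd d(1) by (intro exI[of _ "int d"]) auto
  next
    case False
    have "(f i, f i) \<in> E ^^ (d + m)"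
      using path[of i d] relpow_sym[OF GD(5) assms] fj by (auto simp: relpow_add)
    then have "d + m \<ge> g" using shortest False by (meson not_le)
    moreover have "int g dvd j - i - (int d - int g)"
    proof -
      have "j - i - (int d - int g) = (j - i - int d) + int g * 1" by simp
      then show ?thesis using dvd by (simp only: dvd_add_times_triv_right_iff dvd_add dvd_triv_left)
    qed
    ultimately show ?thesis using False odd_g d(1)
      by (intro exI[of _ "int d - int g"]) auto
  qed
qed

lemma f_eq_iff: "f i = f j \<longleftrightarrow> int g dvd j - i"
proof
  assume "f i = f j"
  then show "int g dvd j - i" using detour[of i j 0] by auto
next
  assume "int g dvd j - i"
  then show "f i = f j" by (intro f_cong) (simp add: dvd_diff_commute)
qed

lemma chord: 
  assumes "(f i, f j) \<in> E"
  shows "int g dvd j - i - 1 \<or> int g dvd j - i + 1"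
proof -
  obtain r where r: "\<bar>r\<bar> \<le> 1" "even (r + 1)" "int g dvd j - i - r"
    using detour[of i j 1] assms by auto
  from r(1,2) have "r = 1 \<or> r = - 1" by presburger
  then show ?thesis using r(3) by auto
qed

end

locale shortest_odd_cycle = shortest_odd_walk +
  assumes g5: "g \<ge> 5"
begin

text \<open>Apart from 1 these are the displacements by which incompatible positions of cycle
  neighbours differ. As \<open>g\<close> is odd, dividing 6 or 8 would mean dividing 3 or 2.\<close>

lemma not_dvd_small:
  assumes "n \<in> {1, 2, 4, 6, 8}"
  shows "\<not> int g dvd n"
proof
  assume *: "int g dvd n"
  have co: "coprime (int g) 2" using odd_g by simp
  have pos: "n > 0" using assms by auto
  have "int g \<le> n" using * pos by (rule zdvd_imp_le)
  then have n: "n = 6 \<or> n = 8" using assms g5 by auto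
  then have "int g dvd 2 * 3 \<or> int g dvd 2 * (2 * 2)" using * by auto
  then have "int g dvd 3 \<or> int g dvd 2" unfolding coprime_dvd_mult_right_iff[OF co] by simp
  then show False using zdvd_imp_le[of "int g" 3] zdvd_imp_le[of "int g" 2] g5 by auto
qed

lemma common_neighbour:
  assumes "(u, f i) \<in> E" "(u, f j) \<in> E"
  shows "int g dvd j - i \<or> int g dvd j - i - 2 \<or> int g dvd j - i + 2"
proof -
  have "(f i, f j) \<in> E ^^ 2" using assms GD(7) by (auto simp: numeral_2_eq_2)
  from detour[OF this] obtain r where r: "\<bar>r\<bar> \<le> 2" "even r" "int g dvd j - i - r" by auto
  from r(1,2) have "r = 0 \<or> r = 2 \<or> r = - 2" by presburger
  then show ?thesis using r(3) by auto
qed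

lemma cross_neighbour:
  assumes "(u, f i) \<in> E" "(w, f j) \<in> E" "(u, w) \<in> E"
  shows "int g dvd j - i - 1 \<or> int g dvd j - i + 1 \<or> int g dvd j - i - 3 \<or> int g dvd j - i + 3"
proof -
  have "(f i, u) \<in> E" using assms(1) GD(7) by simp
  then have "(f i, f j) \<in> E ^^ 3" using assms(2,3) by (auto simp: numeral_3_eq_3)
  from detour[OF this] obtain r where r: "\<bar>r\<bar> \<le> 3" "even (r + 3)" "int g dvd j - i - r" by auto
  from r(1,2) have "r = 1 \<or> r = - 1 \<or> r = 3 \<or> r = - 3" by presburger
  then show ?thesis using r(3) by auto
qed

end

section \<open>Blow-ups of cycles\<close>

text \<open>The type \<open>\<tau> v\<close> is the vertex of \<open>C\<^sub>g\<close> that \<open>v\<close> replaces; it matters only modulo \<open>g\<close>.\<close>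

definition cycle_blowup :: "nat \<Rightarrow> 'a set \<Rightarrow> ('a \<Rightarrow> int) \<Rightarrow> ('a \<times> 'a) set" where
  "cycle_blowup g V \<tau> = {(u, v) \<in> V \<times> V. int g dvd \<tau> v - \<tau> u - 1 \<or> int g dvd \<tau> u - \<tau> v - 1}"

text \<open>Each step changes the type by 1 or -1 modulo \<open>g\<close>; \<open>m\<close> is the
  sum of these signs, the displacement of the walk lifted to the integer line.\<close>

lemma cycle_blowup_walk:
  assumes "(a, b) \<in> cycle_blowup g V \<tau> ^^ l"
  shows "\<exists>m. \<bar>m\<bar> \<le> int l \<and> even (m + int l) \<and> int g dvd \<tau> b - \<tau> a - m"
  using assms
proof (induction l arbitrary: b)
  case 0
  then show ?case by (auto intro!: exI[of _ 0])
next
  case (Suc l)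
  then obtain c where c: "(a, c) \<in> cycle_blowup g V \<tau> ^^ l" "(c, b) \<in> cycle_blowup g V \<tau>" by auto
  obtain m where m: "\<bar>m\<bar> \<le> int l" "even (m + int l)" "int g dvd \<tau> c - \<tau> a - m"
    using Suc.IH[OF c(1)] by blast
  from c(2) consider "int g dvd \<tau> b - \<tau> c - 1" | "int g dvd \<tau> c - \<tau> b - 1"
    by (auto simp: cycle_blowup_def)
  then show ?case
  proof cases
    case 1
    have "\<tau> b - \<tau> a - (m + 1) = (\<tau> c - \<tau> a - m) + (\<tau> b - \<tau> c - 1)" by simp
    then have "int g dvd \<tau> b - \<tau> a - (m + 1)" using m(3) 1 by (metis dvd_add)
    then show ?thesis using m(1,2) by (intro exI[of _ "m + 1"]) auto
  next
    case 2
    have "\<tau> b - \<tau> a - (m - 1) = (\<tau> c - \<tau> a - m) - (\<tau> c - \<tau> b - 1)" by simp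
    then have "int g dvd \<tau> b - \<tau> a - (m - 1)" using m(3) 2 by (metis dvd_diff)
    then show ?thesis using m(1,2) by (intro exI[of _ "m - 1"]) auto
  qed
qed

lemma admissible_cycle_blowup:
  assumes "finite V" "odd g" "g \<ge> 2 * k + 3" and onto: "\<And>i. \<exists>v\<in>V. int g dvd \<tau> v - i"
  shows "admissible k V (cycle_blowup g V \<tau>)"
  unfolding admissible_def
proof (intro conjI allI impI)
  show "graph_on V (cycle_blowup g V \<tau>)"
    unfolding graph_on_def
  proof (intro conjI)
    show "V \<noteq> {}" using onto by blast
    show "sym (cycle_blowup g V \<tau>)" by (auto simp: sym_def cycle_blowup_def)
    have "\<not> int g dvd - 1" using assms(3) by simp
    then show "irrefl (cycle_blowup g V \<tau>)" by (auto simp: irrefl_def cycle_blowup_def)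
  qed (auto simp: cycle_blowup_def assms(1))
next
  fix l a assume l: "odd l \<and> l \<le> 2 * k + 1"
  show "(a, a) \<notin> cycle_blowup g V \<tau> ^^ l"
  proof
    assume "(a, a) \<in> cycle_blowup g V \<tau> ^^ l"
    from cycle_blowup_walk[OF this] obtain m where
      m: "\<bar>m\<bar> \<le> int l" "even (m + int l)" "int g dvd m" by auto
    \<comment> \<open>The displacement of a closed walk is divisible by \<open>g\<close>, but here
      it is smaller than \<open>g\<close> in absolute value; displacement 0 would make
      \<open>l\<close> even.\<close>
    have "m = 0" using m(1,3) l assms(3) zdvd_imp_le[of "int g" "\<bar>m\<bar>"] by (cases "m = 0") auto
    then show False using m(2) l by simp
  qed
next
  \<comment> \<open>Reducing \<open>i\<close> before the choice makes the representatives periodic,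
    so the walk through them closes after \<open>g\<close> steps.\<close>
  define h where "h i = (SOME v. v \<in> V \<and> int g dvd \<tau> v - i mod int g)" for i
  have h: "h i \<in> V" "int g dvd \<tau> (h i) - i mod int g" for i
    using someI_ex[of "\<lambda>v. v \<in> V \<and> int g dvd \<tau> v - i mod int g"] onto[of "i mod int g"]
    unfolding h_def by blast+
  have hi: "int g dvd \<tau> (h i) - i" for i
    using h(2)[of i] by (metis mod_eq_dvd_iff mod_mod_trivial)
  have "(h i, h (i + 1)) \<in> cycle_blowup g V \<tau>" for i
  proof -
    have "\<tau> (h (i + 1)) - \<tau> (h i) - 1 = (\<tau> (h (i + 1)) - (i + 1)) - (\<tau> (h i) - i)" by simp
    then have "int g dvd \<tau> (h (i + 1)) - \<tau> (h i) - 1" using hi by (metis dvd_diff)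
    then show ?thesis using h(1) by (simp add: cycle_blowup_def)
  qed
  from relpow_int_sequence[of h, OF this, of 0 g]
  have "(h 0, h (int g)) \<in> cycle_blowup g V \<tau> ^^ g" by simp
  moreover have "h (int g) = h 0" by (simp add: h_def)
  ultimately show "\<exists>l a. odd l \<and> (a, a) \<in> cycle_blowup g V \<tau> ^^ l" using assms(2) by auto
qed

lemma perron_pos_neighbour:
  assumes G: "graph_on V E" and x: "perron V E x" and E: "(v, w) \<in> E" and w: "x w > 0"
  shows "x v > 0"
proof -
  note D = graph_onD[OF G]
  have v: "v \<in> V" using D(9) E by blast
  have "x w \<le> sum x (E `` {v})"
    using x E D(9,10) by (intro member_le_sum) (auto simp: perron_def)
  also have "\<dots> = lam V E * x v" using x v by (simp add: perron_def)
  finally have "x v \<noteq> 0" using w by auto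
  then show ?thesis using x v by (auto simp: perron_def less_le)
qed

lemma perron_cycle_blowup_pos:
  assumes G: "graph_on V (cycle_blowup g V \<tau>)" and x: "perron V (cycle_blowup g V \<tau>) x"
    and onto: "\<And>i. \<exists>v\<in>V. int g dvd \<tau> v - i" and g: "g > 0" and v: "v \<in> V"
  shows "x v > 0"
proof -
  obtain v0 where v0: "v0 \<in> V" "x v0 > 0" using x by (auto simp: perron_def)
  \<comment> \<open>Positivity spreads from class to class, none being empty. The count starts at 1:
    twins of \<open>v0\<close> are not adjacent to it and are covered by a full turn,
    \<open>m = g - 1\<close>.\<close>
  have *: "\<forall>v\<in>V. int g dvd \<tau> v - \<tau> v0 - int (Suc m) \<longrightarrow> x v > 0" for m
  proof (induction m)
    case 0
    show ?case
    proof (intro ballI impI)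
      fix v assume v: "v \<in> V" "int g dvd \<tau> v - \<tau> v0 - int (Suc 0)"
      then have "(v, v0) \<in> cycle_blowup g V \<tau>" using v0(1) by (simp add: cycle_blowup_def)
      then show "x v > 0" using perron_pos_neighbour[OF G x] v0(2) by blast
    qed
  next
    case (Suc m)
    obtain w where w: "w \<in> V" "int g dvd \<tau> w - (\<tau> v0 + int (Suc m))" using onto by blast
    then have xw: "x w > 0" using Suc by (auto simp: algebra_simps)
    show ?case
    proof (intro ballI impI)
      fix v assume v: "v \<in> V" "int g dvd \<tau> v - \<tau> v0 - int (Suc (Suc m))"
      have "\<tau> v - \<tau> w - 1 = (\<tau> v - \<tau> v0 - int (Suc (Suc m))) - (\<tau> w - (\<tau> v0 + int (Suc m)))"
        by simp
      then have "int g dvd \<tau> v - \<tau> w - 1" using w(2) v(2) by (metis dvd_diff)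
      then have "(v, w) \<in> cycle_blowup g V \<tau>" using w v by (simp add: cycle_blowup_def)
      then show "x v > 0" using perron_pos_neighbour[OF G x] xw by blast
    qed
  qed
  define m where "m = nat ((\<tau> v - \<tau> v0 - 1) mod int g)"
  have "int m = (\<tau> v - \<tau> v0 - 1) mod int g" using g by (simp add: m_def)
  then have "int g dvd \<tau> v - \<tau> v0 - 1 - int m" by (simp add: mod_eq_dvd_iff)
  then have "int g dvd \<tau> v - \<tau> v0 - int (Suc m)" by (simp add: algebra_simps)
  then show ?thesis using * v by blast
qed

section \<open>Eigenvalue bound, clones, and attachment of vertices to the cycle\<close>

context shortest_odd_cycle
begin

lemma not_dvd_small_abs:
  assumes "\<bar>n\<bar> \<in> {1, 2, 4, 6, 8}"
  shows "\<not> int g dvd n"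
  using not_dvd_small[OF assms] by simp

text \<open>The test vector is the indicator of the cycle. The bound 2, and not just positivity, is
  what makes the sequence of mirror differences in \<open>class_sizes_near\<close> concave.\<close>

lemma lam_ge_2: "lam V E \<ge> 2"
proof -
  define y where "y v = (if v \<in> range f then 1 else 0 :: real)" for v
  have "2 * sqnorm V y = (\<Sum>v\<in>V. y v * 2)"
    unfolding sqnorm_def sum_distrib_left by (rule sum.cong) (auto simp: y_def)
  also have "\<dots> \<le> (\<Sum>v\<in>V. y v * sum y (E `` {v}))"
  proof (rule sum_mono)
    fix v
    show "y v * 2 \<le> y v * sum y (E `` {v})"
    proof (cases "v \<in> range f")
      case True
      then obtain i where i: "v = f i" by blast
      have "f (i + 1) \<noteq> f (i - 1)" using not_dvd_small_abs[of "-2"] by (simp add: f_eq_iff)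
      then have "sum y {f (i + 1), f (i - 1)} = 2" by (simp add: y_def)
      moreover have "sum y {f (i + 1), f (i - 1)} \<le> sum y (E `` {v})"
        using step[of i] step[of "i - 1"] GD(7,10) i
        by (intro sum_mono2) (auto simp: y_def)
      ultimately show ?thesis by (simp add: y_def)
    qed (simp add: y_def)
  qed
  also have "\<dots> = qform E y" by (rule qform_eq_sum_neighbours[OF G, symmetric])
  also have "\<dots> \<le> lam V E * sqnorm V y" by (rule lam_rayleigh(1)[OF G])
  finally have "2 * sqnorm V y \<le> lam V E * sqnorm V y" .
  moreover have "sqnorm V y > 0"
    by (rule sqnorm_pos[of _ "f 0"]) (auto simp: GD(1) f_in_V y_def)
  ultimately show ?thesis by simp
qed

lemma admissible_clone:
  assumes "admissible k V E" "u \<in> V" "u \<notin> range f" "v \<noteq> u" "(u, v) \<notin> E"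
  shows "admissible k V (clone E u v)"
  unfolding admissible_def
proof (intro conjI allI impI)
  show "graph_on V (clone E u v)" using graph_on_clone[OF G assms(2,5)] .
next
  fix l a assume "odd l \<and> l \<le> 2 * k + 1"
  then show "(a, a) \<notin> clone E u v ^^ l"
    using relpow_clone[OF G assms(5,4)] assms(1) unfolding admissible_def by blast
next
  have "(f i, f (i + 1)) \<in> clone E u v" for i
    using step[of i] assms(3) by (auto simp: clone_def)
  from relpow_int_sequence[of f, OF this, of 0 g] have "(f 0, f 0) \<in> clone E u v ^^ g"
    using period[of 0] by simp
  then show "\<exists>l a. odd l \<and> (a, a) \<in> clone E u v ^^ l" using odd_g by blast
qed

text \<open>Besides \<open>i0\<close> only \<open>i0 + 2\<close> and \<open>i0 - 2\<close> can occur
  modulo \<open>g\<close>, and not both, as they differ by 4. What remains lies on both sides of one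
  centre.\<close>

lemma single_pattern:
  fixes P :: "int \<Rightarrow> bool"
  assumes PP: "\<And>i j. P i \<Longrightarrow> P j \<Longrightarrow> int g dvd j - i \<or> int g dvd j - i - 2 \<or> int g dvd j - i + 2"
    and per: "\<And>i j. P i \<Longrightarrow> int g dvd j - i \<Longrightarrow> P j"
  shows "\<exists>c. \<forall>i. P i \<longrightarrow> int g dvd i - c - 1 \<or> int g dvd i - c + 1"
proof (cases "\<exists>i. P i")
  case True
  then obtain i0 where i0: "P i0" by blast
  show ?thesis
  proof (cases "P (i0 + 2)")
    case True
    have "int g dvd i - (i0 + 1) - 1 \<or> int g dvd i - (i0 + 1) + 1" if "P i" for i
    proof -
      have "\<not> int g dvd i - i0 + 2"
      proof
        assume "int g dvd i - i0 + 2"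
        then have "P (i0 - 2)" using per[OF that, of "i0 - 2"]
          by (simp add: dvd_diff_commute algebra_simps)
        from PP[OF True this] show False
          using not_dvd_small_abs[of "-4"] not_dvd_small_abs[of "-6"] not_dvd_small_abs[of "-2"] by simp
      qed
      then show ?thesis using PP[OF i0 that] by (auto simp: algebra_simps)
    qed
    then show ?thesis by blast
  next
    case False
    have "int g dvd i - (i0 - 1) - 1 \<or> int g dvd i - (i0 - 1) + 1" if "P i" for i
    proof -
      have "\<not> int g dvd i - i0 - 2"
        using per[OF that, of "i0 + 2"] False by (auto simp: dvd_diff_commute algebra_simps)
      then show ?thesis using PP[OF i0 that] by (auto simp: algebra_simps)
    qed
    then show ?thesis by blast
  qed
qed blast

text \<open>Here \<open>P\<close> and \<open>Q\<close> are the positions of the cycle neighbours of two adjacent vertices off the cycle,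
  and \<open>\<alpha>\<close>, \<open>\<beta>\<close> are the types that these two vertices can be given.\<close>

lemma cross_pattern:
  fixes P Q :: "int \<Rightarrow> bool"
  assumes PP: "\<And>i j. P i \<Longrightarrow> P j \<Longrightarrow> int g dvd j - i \<or> int g dvd j - i - 2 \<or> int g dvd j - i + 2"
    and QQ: "\<And>i j. Q i \<Longrightarrow> Q j \<Longrightarrow> int g dvd j - i \<or> int g dvd j - i - 2 \<or> int g dvd j - i + 2"
    and PQ: "\<And>i j. P i \<Longrightarrow> Q j \<Longrightarrow>
      int g dvd j - i - 1 \<or> int g dvd j - i + 1 \<or> int g dvd j - i - 3 \<or> int g dvd j - i + 3"
    and perP: "\<And>i j. P i \<Longrightarrow> int g dvd j - i \<Longrightarrow> P j"
    and perQ: "\<And>i j. Q i \<Longrightarrow> int g dvd j - i \<Longrightarrow> Q j"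
  shows "\<exists>\<alpha> \<beta>. (\<beta> = \<alpha> + 1 \<or> \<alpha> = \<beta> + 1) \<and>
    (\<forall>i. P i \<longrightarrow> int g dvd i - \<alpha> - 1 \<or> int g dvd i - \<alpha> + 1) \<and>
    (\<forall>j. Q j \<longrightarrow> int g dvd j - \<beta> - 1 \<or> int g dvd j - \<beta> + 1)"
proof (cases "\<exists>i. P i")
  case False
  have "\<exists>\<beta>. \<forall>j. Q j \<longrightarrow> int g dvd j - \<beta> - 1 \<or> int g dvd j - \<beta> + 1"
    by (rule single_pattern) (use QQ perQ in blast)+
  then obtain \<beta> where "\<forall>j. Q j \<longrightarrow> int g dvd j - \<beta> - 1 \<or> int g dvd j - \<beta> + 1" ..
  then show ?thesis using False by (intro exI[of _ "\<beta> + 1"] exI[of _ \<beta>]) blast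
next
  case True
  then obtain i0 where i0: "P i0" by blast
  have P: "(int g dvd i - i0) \<or> (int g dvd i - i0 - 2 \<and> P (i0 + 2)) \<or> (int g dvd i - i0 + 2 \<and> P (i0 - 2))"
    if "P i" for i
  proof -
    have "int g dvd i - i0 - 2 \<Longrightarrow> P (i0 + 2)"
      using perP[OF that, of "i0 + 2"] by (simp add: dvd_diff_commute algebra_simps)
    moreover have "int g dvd i - i0 + 2 \<Longrightarrow> P (i0 - 2)"
      using perP[OF that, of "i0 - 2"] by (simp add: dvd_diff_commute algebra_simps)
    ultimately show ?thesis using PP[OF i0 that] by blast
  qed
  have Q: "(int g dvd i - i0 - 1 \<and> Q (i0 + 1)) \<or> (int g dvd i - i0 + 1 \<and> Q (i0 - 1)) \<or>
      (int g dvd i - i0 - 3 \<and> Q (i0 + 3)) \<or> (int g dvd i - i0 + 3 \<and> Q (i0 - 3))"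
    if "Q i" for i
  proof -
    have "int g dvd i - i0 - 1 \<Longrightarrow> Q (i0 + 1)"
      using perQ[OF that, of "i0 + 1"] by (simp add: dvd_diff_commute algebra_simps)
    moreover have "int g dvd i - i0 + 1 \<Longrightarrow> Q (i0 - 1)"
      using perQ[OF that, of "i0 - 1"] by (simp add: dvd_diff_commute algebra_simps)
    moreover have "int g dvd i - i0 - 3 \<Longrightarrow> Q (i0 + 3)"
      using perQ[OF that, of "i0 + 3"] by (simp add: dvd_diff_commute algebra_simps)
    moreover have "int g dvd i - i0 + 3 \<Longrightarrow> Q (i0 - 3)"
      using perQ[OF that, of "i0 - 3"] by (simp add: dvd_diff_commute algebra_simps)
    ultimately show ?thesis using PQ[OF i0 that] by blast
  qed
  have n: "\<not> int g dvd 2" "\<not> int g dvd 4" "\<not> int g dvd 6" "\<not> int g dvd 8"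
    "\<not> int g dvd -2" "\<not> int g dvd -4" "\<not> int g dvd -6" "\<not> int g dvd -8"
    using not_dvd_small by auto
  \<comment> \<open>Each of these pairs would make \<open>g\<close> divide one of 2, 4, 6,
    8.\<close>
  have e: "\<not> (P (i0 + 2) \<and> P (i0 - 2))" "\<not> (Q (i0 - 3) \<and> Q (i0 + 1))" "\<not> (Q (i0 - 3) \<and> Q (i0 + 3))"
     "\<not> (Q (i0 - 1) \<and> Q (i0 + 3))" "\<not> (P (i0 + 2) \<and> Q (i0 - 3))" "\<not> (P (i0 - 2) \<and> Q (i0 + 3))"
    using PP[of "i0 + 2" "i0 - 2"] QQ[of "i0 - 3" "i0 + 1"] QQ[of "i0 - 3" "i0 + 3"]
      QQ[of "i0 - 1" "i0 + 3"] PQ[of "i0 + 2" "i0 - 3"] PQ[of "i0 - 2" "i0 + 3"] n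
    by auto
  \<comment> \<open>Relative to \<open>i0\<close>, \<open>P\<close> lies in -2, 0, 2 and
    \<open>Q\<close> in -3, -1, 1, 3. The four cases are the windows of two positions each, around
    consecutive centres \<open>\<alpha>\<close> and \<open>\<beta>\<close>, that survive the
    exclusions.\<close>
  consider "\<not> P (i0 + 2)" "\<not> Q (i0 + 1)" "\<not> Q (i0 + 3)"
    | "\<not> P (i0 - 2)" "\<not> Q (i0 + 3)" "\<not> Q (i0 - 3)"
    | "\<not> P (i0 - 2)" "\<not> Q (i0 - 1)" "\<not> Q (i0 - 3)"
    | "\<not> P (i0 + 2)" "\<not> Q (i0 + 3)" "\<not> Q (i0 - 3)"
    using e by blast
  then show ?thesis
  proof cases
    case 1
    then show ?thesis using P Q
      by (intro exI[of _ "i0 - 1"] exI[of _ "i0 - 2"]) (fastforce simp: algebra_simps)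
  next
    case 2
    then show ?thesis using P Q
      by (intro exI[of _ "i0 + 1"] exI[of _ "i0"]) (fastforce simp: algebra_simps)
  next
    case 3
    then show ?thesis using P Q
      by (intro exI[of _ "i0 + 1"] exI[of _ "i0 + 2"]) (fastforce simp: algebra_simps)
  next
    case 4
    then show ?thesis using P Q
      by (intro exI[of _ "i0 - 1"] exI[of _ "i0"]) (fastforce simp: algebra_simps)
  qed
qed

end

section \<open>The structure of extremal graphs\<close>

lemma cycle_blowup_sym: "(u, v) \<in> cycle_blowup g V \<tau> \<longleftrightarrow> (v, u) \<in> cycle_blowup g V \<tau>"
  by (auto simp: cycle_blowup_def)

lemma cycle_blowup_iff:
  "(u, v) \<in> cycle_blowup g V \<tau> \<longleftrightarrow>
    u \<in> V \<and> v \<in> V \<and> (int g dvd \<tau> v - \<tau> u - 1 \<or> int g dvd \<tau> v - \<tau> u + 1)"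
proof -
  have "- (\<tau> u - \<tau> v - 1) = \<tau> v - \<tau> u + 1" by simp
  then have "int g dvd \<tau> u - \<tau> v - 1 \<longleftrightarrow> int g dvd \<tau> v - \<tau> u + 1" by (metis dvd_minus_iff)
  then show ?thesis by (simp add: cycle_blowup_def)
qed

text \<open>Adding edges cannot lower the form at a non-negative \<open>x\<close>, so
  \<open>x\<close> is a Perron vector of \<open>B\<close> and therefore positive; an edge in
  \<open>B - E\<close> would then raise the form strictly.\<close>

lemma extremal_supergraph_eq:
  assumes ext: "extremal k V E" and x: "perron V E x" and B: "admissible k V B" "E \<subseteq> B"
    and pos: "\<And>y v. perron V B y \<Longrightarrow> v \<in> V \<Longrightarrow> y v > 0"
  shows "E = B" "\<And>v. v \<in> V \<Longrightarrow> x v > 0"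
proof -
  have G: "graph_on V B" using B by (simp add: admissible_def)
  have x0: "x v \<ge> 0" if "v \<in> V" for v using x that by (auto simp: perron_def)
  have split: "qform B x = qform E x + qform (B - E) x"
    unfolding qform_def using B(2) graph_onD(4)[OF G] by (subst sum.subset_diff[of E B]) auto
  have nonneg: "qform (B - E) x \<ge> 0"
    unfolding qform_def using x0 graph_onD(9)[OF G] by (intro sum_nonneg) auto
  then have "qform B x \<ge> qform E x" using split by simp
  from extremal_perron_transfer[OF ext x B(1) this]
  have *: "perron V B x" "qform (B - E) x = 0" using split by auto
  show xpos: "x v > 0" if "v \<in> V" for v using pos[OF *(1) that] .
  have "B - E = {}"
  proof (rule ccontr)
    assume "B - E \<noteq> {}"
    then have "qform (B - E) x > 0"
      unfolding qform_def using xpos graph_onD(4,9)[OF G] by (intro sum_pos) auto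
    then show False using *(2) by simp
  qed
  then show "E = B" using B(2) by blast
qed

section \<open>Perron weights and types in an extremal graph\<close>

locale extremal_cycle = shortest_odd_cycle +
  fixes k :: nat and x :: "'a \<Rightarrow> real"
  assumes ext: "extremal k V E" and perron: "perron V E x" and g_ge: "g \<ge> 2 * k + 3"
    and k1: "k \<ge> 1"
begin

lemma admissible: "admissible k V E"
  using ext by (simp add: extremal_def)

lemma x_nonneg: "v \<in> V \<Longrightarrow> x v \<ge> 0"
  and x_eigen: "v \<in> V \<Longrightarrow> sum x (E `` {v}) = lam V E * x v"
  using perron by (auto simp: perron_def)

lemma qform_clone_eigen:
  assumes "u \<in> V" "v \<in> V" "(u, v) \<notin> E"
  shows "qform (clone E u v) x = qform E x + 2 * x u * (lam V E * (x v - x u))"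
  using qform_clone[OF G assms(3), of x] x_eigen assms(1,2) by (simp add: algebra_simps)

lemma off_cycle_nonneighbour_le:
  assumes u: "u \<in> V" "u \<notin> range f" and v: "v \<in> V" "(u, v) \<notin> E"
  shows "x v \<le> x u"
proof (rule ccontr)
  assume "\<not> x v \<le> x u"
  then have less: "x u < x v" "v \<noteq> u" by auto
  note a = admissible_clone[OF admissible u less(2) v(2)]
  have gt: "lam V E * (x v - x u) > 0" using lam_ge_2 less(1) by simp
  have "2 * x u * (lam V E * (x v - x u)) \<ge> 0" using gt x_nonneg[OF u(1)] by simp
  then have "qform (clone E u v) x \<ge> qform E x" using qform_clone_eigen[OF u(1) v] by simp
  note t = extremal_perron_transfer[OF ext perron a this]
  have "2 * x u * (lam V E * (x v - x u)) = 0" using t(3) qform_clone_eigen[OF u(1) v] by simp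
  \<comment> \<open>The gain has the factor \<open>x u\<close> and may vanish. In that case the
    eigen-equation of the clone at \<open>u\<close>, whose neighbours there are those of
    \<open>v\<close>, forces \<open>x v = 0\<close> too.\<close>
  then have xu: "x u = 0" using gt by (metis less_irrefl mult_eq_0_iff zero_neq_numeral)
  have "sum x (clone E u v `` {u}) = lam V (clone E u v) * x u"
    using t(2) u(1) by (simp add: perron_def)
  then have "lam V E * x v = 0" using x_eigen[OF v(1)] clone_image(1)[OF G v(2)] xu by simp
  then show False using lam_ge_2 less(1) xu by simp
qed

text \<open>If \<open>x u\<close> were 0, its neighbours would have weight 0 by the eigen-equation
  and its non-neighbours by comparison, leaving the zero vector.\<close>

lemma off_cycle_pos:
  assumes u: "u \<in> V" "u \<notin> range f"
  shows "x u > 0"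
proof (rule ccontr)
  assume "\<not> x u > 0"
  then have xu: "x u = 0" using x_nonneg[OF u(1)] by simp
  have "x v = 0" if v: "v \<in> V" for v
  proof (cases "(u, v) \<in> E")
    case True
    have "sum x (E `` {u}) = 0" using x_eigen[OF u(1)] xu by simp
    moreover have "\<forall>w\<in>E `` {u}. x w \<ge> 0" using x_nonneg GD(9) by blast
    ultimately have "\<forall>w\<in>E `` {u}. x w = 0" using GD(10) by (subst (asm) sum_nonneg_eq_0_iff) auto
    then show ?thesis using True by blast
  next
    case False
    then show ?thesis using off_cycle_nonneighbour_le[OF u v] xu x_nonneg[OF v] by simp
  qed
  then show False using perron by (auto simp: perron_def)
qed

text \<open>With equal weights \<open>x\<close> is a Perron vector of both \<open>E\<close> and the
  clone, for the same eigenvalue. At \<open>w \<noteq> u\<close> the two eigen-equations differ only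
  in whether \<open>u\<close> is counted, and \<open>x u > 0\<close>.\<close>

lemma off_cycle_twin:
  assumes u: "u \<in> V" "u \<notin> range f" and v: "v \<in> V" "(u, v) \<notin> E" and eq: "x v = x u"
  shows "E `` {u} = E `` {v}"
proof (cases "v = u")
  case False
  note a = admissible_clone[OF admissible u False v(2)]
  have "qform (clone E u v) x \<ge> qform E x" using qform_clone_eigen[OF u(1) v] eq by simp
  note t = extremal_perron_transfer[OF ext perron a this]
  have "w \<in> E `` {u} \<longleftrightarrow> w \<in> E `` {v}" if w: "w \<in> V" "w \<noteq> u" for w
  proof -
    have s: "sum x (clone E u v `` {w}) = sum x (E `` {w})"
      using t(1,2) w(1) x_eigen by (simp add: perron_def)
    have "sum x (E `` {w} - {u}) = sum x (E `` {w}) - (if (w, u) \<in> E then x u else 0)"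
      using GD(10) by (auto simp: sum_diff1)
    moreover have "sum x (clone E u v `` {w}) = sum x (E `` {w} - {u}) + (if (w, v) \<in> E then x u else 0)"
      unfolding clone_image(2)[OF G v(2) w(2)] using GD(10) by (subst sum.union_disjoint) auto
    ultimately have "(if (w, u) \<in> E then x u else 0) = (if (w, v) \<in> E then x u else 0)"
      using s by simp
    then have "(w, u) \<in> E \<longleftrightarrow> (w, v) \<in> E" using off_cycle_pos[OF u] by (auto split: if_splits)
    then show ?thesis using GD(7) by blast
  qed
  then show ?thesis using v(2) GD(7,8,9) by blast
qed simp

lemma off_cycle_nonneighbours_twins:
  assumes "u \<in> V" "u \<notin> range f" "v \<in> V" "v \<notin> range f" "(u, v) \<notin> E"
  shows "E `` {u} = E `` {v}"
proof (rule off_cycle_twin)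
  have "(v, u) \<notin> E" using assms(5) GD(7) by blast
  then show "x v = x u"
    using off_cycle_nonneighbour_le assms by (intro antisym)
qed (use assms in auto)

definition idx :: "'a \<Rightarrow> int" where "idx v = (SOME i. f i = v)"

lemma f_idx: "v \<in> range f \<Longrightarrow> f (idx v) = v"
  unfolding idx_def by (rule someI_ex) auto

lemma idx_f: "int g dvd idx (f i) - i"
  using f_idx[of "f i"] by (metis f_eq_iff dvd_diff_commute rangeI)

abbreviation dvdg :: "int \<Rightarrow> bool" where "dvdg n \<equiv> int g dvd n"

text \<open>The classes of types 1 and 2 are the blown-up ones. The last clause provides a vertex in one of them
  whose Perron weight bounds the weights of the cycle vertices not adjacent to these classes.\<close>

definition typing :: "('a \<Rightarrow> int) \<Rightarrow> bool" where
  "typing \<tau> \<longleftrightarrow> E \<subseteq> cycle_blowup g V \<tau> \<and> (\<forall>i. \<exists>v\<in>V. dvdg (\<tau> v - i)) \<and>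
     (\<forall>u\<in>V. \<forall>v\<in>V. dvdg (\<tau> u - \<tau> v) \<and> u \<noteq> v \<longrightarrow> dvdg (\<tau> u - 1) \<or> dvdg (\<tau> u - 2)) \<and>
     (\<exists>u\<in>V. (dvdg (\<tau> u - 1) \<or> dvdg (\<tau> u - 2)) \<and>
       (\<forall>v\<in>V. \<not> dvdg (\<tau> v) \<and> \<not> dvdg (\<tau> v - 1) \<and> \<not> dvdg (\<tau> v - 2) \<and> \<not> dvdg (\<tau> v - 3) \<longrightarrow> x v \<le> x u))"

lemma cycle_blowup_cycle_edge:
  assumes "(u, v) \<in> E" "u \<in> range f" "v \<in> range f" "\<tau> u = idx u - c" "\<tau> v = idx v - c"
  shows "(u, v) \<in> cycle_blowup g V \<tau>"
proof -
  have "(f (idx u), f (idx v)) \<in> E" using assms(1-3) by (simp add: f_idx)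
  then have "dvdg (idx v - idx u - 1) \<or> dvdg (idx v - idx u + 1)" by (rule chord)
  moreover have "\<tau> v - \<tau> u = idx v - idx u" using assms(4,5) by simp
  ultimately show ?thesis using GD(9)[OF assms(1)] by (simp add: cycle_blowup_iff)
qed

lemma onto_typing:
  assumes "\<And>v. v \<in> range f \<Longrightarrow> \<tau> v = idx v - c"
  shows "\<exists>v\<in>V. dvdg (\<tau> v - i)"
  using idx_f[of "i + c"] assms[of "f (i + c)"] f_in_V
  by (intro bexI[of _ "f (i + c)"]) (auto simp: algebra_simps)

lemma typing_exists_spanning:
  assumes "V = range f"
  shows "\<exists>\<tau>. typing \<tau>"
proof -
  have "Max (x ` V) \<in> x ` V" using GD(1,2) by (intro Max_in) auto
  then obtain m where m: "x (f m) = Max (x ` V)" using assms by auto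
  \<comment> \<open>The shift gives a vertex of maximum weight type 2, so the last clause of
    \<open>typing\<close> holds trivially.\<close>
  define \<tau> where "\<tau> v = idx v - (m - 2)" for v
  have "E \<subseteq> cycle_blowup g V \<tau>"
  proof safe
    fix u v assume "(u, v) \<in> E"
    then show "(u, v) \<in> cycle_blowup g V \<tau>"
      using cycle_blowup_cycle_edge[of u v \<tau> "m - 2"] assms GD(9)[of u v] by (simp add: \<tau>_def)
  qed
  moreover have "\<exists>v\<in>V. dvdg (\<tau> v - i)" for i by (rule onto_typing[of _ "m - 2"]) (simp add: \<tau>_def)
  moreover have "u = v" if "u \<in> V" "v \<in> V" "dvdg (\<tau> u - \<tau> v)" for u v
  proof -
    have "dvdg (idx u - idx v)" using that(3) by (simp add: \<tau>_def)
    then have "f (idx v) = f (idx u)" by (simp add: f_eq_iff)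
    then show ?thesis using that(1,2) assms by (simp add: f_idx)
  qed
  moreover have "dvdg (\<tau> (f m) - 2)" using idx_f[of m] by (simp add: \<tau>_def)
  moreover have "\<forall>v\<in>V. x v \<le> x (f m)" unfolding m using GD(1) by auto
  ultimately show ?thesis unfolding typing_def using f_in_V by blast
qed

lemma typing_exists_nonspanning:
  assumes "V \<noteq> range f"
  shows "\<exists>\<tau>. typing \<tau>"
proof -
  obtain a where a: "a \<in> V" "a \<notin> range f" using assms f_in_V by blast
  define A where "A = {w \<in> V - range f. (a, w) \<notin> E}"
  define B where "B = {w \<in> V - range f. (a, w) \<in> E}"
  have AB: "V - range f = A \<union> B" "A \<inter> B = {}" by (auto simp: A_def B_def)
  have A_twin: "E `` {w} = E `` {a}" if "w \<in> A" for w
    using off_cycle_nonneighbours_twins[OF a, of w] that by (simp add: A_def)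
  have indep_B: "(v, w) \<notin> E" if "v \<in> B" "w \<in> B" for v w
  proof
    assume "(v, w) \<in> E"
    then have "(a, a) \<in> E ^^ 3" using that GD(7)[of a w] by (auto simp: B_def numeral_3_eq_3)
    then show False using shortest[of 3] g5 by auto
  qed
  have B_twin: "E `` {v} = E `` {w}" if "v \<in> B" "w \<in> B" for v w
    using off_cycle_nonneighbours_twins[of v w] indep_B[OF that] that by (simp add: B_def)
  define P where "P i \<longleftrightarrow> (a, f i) \<in> E" for i
  \<comment> \<open>An existential, so that \<open>Q\<close> is false everywhere if \<open>B\<close>
    is empty; otherwise every \<open>b\<close> serves, as the vertices of \<open>B\<close> are
    twins.\<close>
  define Q where "Q i \<longleftrightarrow> (\<exists>b\<in>B. (b, f i) \<in> E)" for i
  have QB: "(b, f i) \<in> E" if "Q i" "b \<in> B" for b i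
    using that B_twin unfolding Q_def by blast
  have per: "f j = f i" if "dvdg (j - i)" for i j using f_eq_iff that by metis
  have "\<exists>\<alpha> \<beta>. (\<beta> = \<alpha> + 1 \<or> \<alpha> = \<beta> + 1) \<and>
    (\<forall>i. P i \<longrightarrow> dvdg (i - \<alpha> - 1) \<or> dvdg (i - \<alpha> + 1)) \<and>
    (\<forall>j. Q j \<longrightarrow> dvdg (j - \<beta> - 1) \<or> dvdg (j - \<beta> + 1))"
  proof (rule cross_pattern)
    fix i j
    show "P i \<Longrightarrow> P j \<Longrightarrow> dvdg (j - i) \<or> dvdg (j - i - 2) \<or> dvdg (j - i + 2)"
      unfolding P_def by (rule common_neighbour)
    show "Q i \<Longrightarrow> Q j \<Longrightarrow> dvdg (j - i) \<or> dvdg (j - i - 2) \<or> dvdg (j - i + 2)"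
      using QB common_neighbour unfolding Q_def by meson
    show "P i \<Longrightarrow> Q j \<Longrightarrow> dvdg (j - i - 1) \<or> dvdg (j - i + 1) \<or> dvdg (j - i - 3) \<or> dvdg (j - i + 3)"
      using cross_neighbour unfolding P_def Q_def B_def by blast
    show "P i \<Longrightarrow> dvdg (j - i) \<Longrightarrow> P j" using per unfolding P_def by metis
    show "Q i \<Longrightarrow> dvdg (j - i) \<Longrightarrow> Q j" using per unfolding Q_def by metis
  qed
  then obtain \<alpha> \<beta> where ab: "\<beta> = \<alpha> + 1 \<or> \<alpha> = \<beta> + 1"
    and P: "\<And>i. P i \<Longrightarrow> dvdg (i - \<alpha> - 1) \<or> dvdg (i - \<alpha> + 1)"
    and Q: "\<And>i. Q i \<Longrightarrow> dvdg (i - \<beta> - 1) \<or> dvdg (i - \<beta> + 1)"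
    by blast
  \<comment> \<open>Consecutive \<open>\<alpha>\<close> and \<open>\<beta>\<close> become 1 and 2 in
    some order, the types that \<open>typing\<close> reserves for the blown-up classes.\<close>
  define c where "c = min \<alpha> \<beta> - 1"
  have c: "(\<alpha> - c = 1 \<and> \<beta> - c = 2) \<or> (\<alpha> - c = 2 \<and> \<beta> - c = 1)" using ab by (auto simp: c_def)
  define \<tau> where "\<tau> v = (if v \<in> A then \<alpha> - c else if v \<in> B then \<beta> - c else idx v - c)" for v
  have \<tau>A: "\<tau> v = \<alpha> - c" if "v \<in> A" for v using that by (simp add: \<tau>_def)
  have \<tau>B: "\<tau> v = \<beta> - c" if "v \<in> B" for v using that AB(2) by (auto simp: \<tau>_def)
  have \<tau>C: "\<tau> v = idx v - c" if "v \<in> range f" for v using that AB(1) by (auto simp: \<tau>_def)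
  have aA: "a \<in> A" using a GD(8) by (simp add: A_def)
  have cycle_blowup_sub: "(u, v) \<in> cycle_blowup g V \<tau>" if E: "(u, v) \<in> E" and u: "u \<in> A \<or> u \<in> B" for u v
  proof -
    have V: "u \<in> V" "v \<in> V" using GD(9)[OF E] by auto
    from u show ?thesis
    proof
      assume u: "u \<in> A"
      then have av: "(a, v) \<in> E" using A_twin E by blast
      then have "v \<notin> A" by (simp add: A_def)
      then consider "v \<in> B" | "v \<in> range f" using AB(1) V(2) by blast
      then show ?thesis
      proof cases
        case 1
        have "\<tau> v - \<tau> u = 1 \<or> \<tau> v - \<tau> u = - 1" unfolding \<tau>A[OF u] \<tau>B[OF 1] using ab by auto
        then show ?thesis using V by (auto simp: cycle_blowup_iff)
      next
        case 2
        then have "P (idx v)" using av f_idx[OF 2] by (simp add: P_def)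
        from P[OF this] have "dvdg (\<tau> v - \<tau> u - 1) \<or> dvdg (\<tau> v - \<tau> u + 1)"
          unfolding \<tau>A[OF u] \<tau>C[OF 2] by simp
        then show ?thesis using V by (simp add: cycle_blowup_iff)
      qed
    next
      assume u: "u \<in> B"
      then have "v \<notin> B" using indep_B E by blast
      then consider "v \<in> A" | "v \<in> range f" using AB(1) V(2) by blast
      then show ?thesis
      proof cases
        case 1
        have "\<tau> v - \<tau> u = 1 \<or> \<tau> v - \<tau> u = - 1" unfolding \<tau>A[OF 1] \<tau>B[OF u] using ab by auto
        then show ?thesis using V by (auto simp: cycle_blowup_iff)
      next
        case 2
        then have "Q (idx v)" using E u f_idx[OF 2] by (auto simp: Q_def)
        from Q[OF this] have "dvdg (\<tau> v - \<tau> u - 1) \<or> dvdg (\<tau> v - \<tau> u + 1)"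
          unfolding \<tau>B[OF u] \<tau>C[OF 2] by simp
        then show ?thesis using V by (simp add: cycle_blowup_iff)
      qed
    qed
  qed
  have "E \<subseteq> cycle_blowup g V \<tau>"
  proof safe
    fix u v assume E: "(u, v) \<in> E"
    note V = GD(9)[OF E]
    show "(u, v) \<in> cycle_blowup g V \<tau>"
    proof (cases "u \<in> range f \<and> v \<in> range f")
      case True
      then show ?thesis using cycle_blowup_cycle_edge[OF E] \<tau>C[of u] \<tau>C[of v] by simp
    next
      case False
      then have "(u \<in> A \<or> u \<in> B) \<or> (v \<in> A \<or> v \<in> B)" using V AB(1) by blast
      then show ?thesis using cycle_blowup_sub[OF E] cycle_blowup_sub[OF GD(7)[OF E]] cycle_blowup_sym[of u v g V \<tau>] by blast
    qed
  qed
  moreover have "\<exists>v\<in>V. dvdg (\<tau> v - i)" for i 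
    using onto_typing[of \<tau> c] \<tau>C by blast
  moreover have "dvdg (\<tau> u - 1) \<or> dvdg (\<tau> u - 2)"
    if uv: "u \<in> V" "v \<in> V" "dvdg (\<tau> u - \<tau> v)" "u \<noteq> v" for u v
  proof -
    have in12: "\<tau> w = 1 \<or> \<tau> w = 2" if "w \<in> V" "w \<notin> range f" for w
    proof -
      have "w \<in> A \<or> w \<in> B" using that AB(1) by blast
      then show ?thesis using \<tau>A[of w] \<tau>B[of w] c by auto
    qed
    show ?thesis
    proof (cases "u \<in> range f")
      case True
      have "v \<notin> range f"
      proof
        assume v: "v \<in> range f"
        then have "dvdg (idx u - idx v)" using uv(3) \<tau>C[OF v] \<tau>C[OF True] by simp
        then have "f (idx v) = f (idx u)" by (simp add: f_eq_iff)
        then show False using f_idx[OF v] f_idx[OF True] uv(4) by simp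
      qed
      then show ?thesis using in12[OF uv(2)] uv(3) by auto
    next
      case False
      then show ?thesis using in12[OF uv(1)] by auto
    qed
  qed
  moreover have "dvdg (\<tau> a - 1) \<or> dvdg (\<tau> a - 2)" using \<tau>A[OF aA] c by auto
  moreover have "x v \<le> x a"
    if v: "v \<in> V" "\<not> dvdg (\<tau> v)" "\<not> dvdg (\<tau> v - 1)" "\<not> dvdg (\<tau> v - 2)" "\<not> dvdg (\<tau> v - 3)" for v
  proof -
    have "v \<notin> A" "v \<notin> B" using v(3,4) \<tau>A[of v] \<tau>B[of v] c by auto
    then have "v \<in> range f" using v(1) AB(1) by blast
    \<comment> \<open>The cycle neighbours of \<open>a\<close> lie beside its type, which is 1 or 2,
      so they have types 0 to 3. Every other cycle vertex is a non-neighbour of \<open>a\<close>,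
      and the comparison bounds its weight.\<close>
    have "(a, v) \<notin> E"
    proof
      assume E: "(a, v) \<in> E"
      then have "P (idx v)" using f_idx[OF \<open>v \<in> range f\<close>] by (simp add: P_def)
      from P[OF this] have "dvdg (\<tau> v - (\<alpha> - c) - 1) \<or> dvdg (\<tau> v - (\<alpha> - c) + 1)"
        unfolding \<tau>C[OF \<open>v \<in> range f\<close>] by simp
      with c have "dvdg (\<tau> v - 2) \<or> dvdg (\<tau> v) \<or> dvdg (\<tau> v - 3) \<or> dvdg (\<tau> v - 1)" by force
      then show False using v by blast
    qed
    then show ?thesis using off_cycle_nonneighbour_le[OF a v(1)] by blast
  qed
  ultimately show ?thesis unfolding typing_def using a(1) by blast
qed

lemma typing_exists: "\<exists>\<tau>. typing \<tau>"
  using typing_exists_spanning typing_exists_nonspanning by blast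

lemma typing_cycle_blowup:
  assumes "typing \<tau>"
  shows "E = cycle_blowup g V \<tau>" "\<And>v. v \<in> V \<Longrightarrow> x v > 0"
proof -
  have onto: "\<exists>v\<in>V. int g dvd \<tau> v - i" for i using assms by (auto simp: typing_def)
  have B: "admissible k V (cycle_blowup g V \<tau>)"
    using admissible_cycle_blowup[of V g k \<tau>, OF GD(1) odd_g g_ge onto] .
  then have GB: "graph_on V (cycle_blowup g V \<tau>)" by (simp add: admissible_def)
  have sub: "E \<subseteq> cycle_blowup g V \<tau>" using assms by (simp add: typing_def)
  have pos: "y v > 0" if "perron V (cycle_blowup g V \<tau>) y" "v \<in> V" for y v
    using perron_cycle_blowup_pos[OF GB that(1) onto _ that(2)] g5 by simp
  show "E = cycle_blowup g V \<tau>" "\<And>v. v \<in> V \<Longrightarrow> x v > 0"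
    using extremal_supergraph_eq[of k V E x "cycle_blowup g V \<tau>"] ext perron B sub pos by simp_all
qed

end

section \<open>Residues of types, class sizes, and local changes of the form\<close>

definition class_size :: "nat \<Rightarrow> 'a set \<Rightarrow> ('a \<Rightarrow> int) \<Rightarrow> int \<Rightarrow> nat" where
  "class_size g V \<tau> i = card {w \<in> V. int g dvd \<tau> w - i}"

lemma dvd_diff_cong:
  fixes d :: int
  assumes "d dvd i - j"
  shows "d dvd a - i \<longleftrightarrow> d dvd a - j"
  using assms unfolding mod_eq_dvd_iff[symmetric] by simp

lemma dvd_small_iff:
  fixes m n :: int
  assumes "- n \<le> m" "m < n"
  shows "n dvd m \<longleftrightarrow> m = 0 \<or> m = - n"
proof
  assume "n dvd m"
  then obtain c where c: "m = n * c" by (elim dvdE)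
  have n: "n > 0" using assms by linarith
  have "n * c < n * 1" "n * (- 1) \<le> n * c" using assms c by auto
  then have "c < 1" "- 1 \<le> c" using n by (simp_all only: mult_less_cancel_left_pos mult_le_cancel_left_pos)
  then have "c = 0 \<or> c = - 1" by linarith
  then show "m = 0 \<or> m = - n" using c by auto
qed auto

text \<open>Adjacency in \<open>C\<^sub>n\<close> on the residues 0 to \<open>n - 1\<close>, written
  with equations so that linear arithmetic decides it, also when \<open>n\<close> changes.\<close>

definition cyc_adj :: "int \<Rightarrow> int \<Rightarrow> int \<Rightarrow> bool" where
  "cyc_adj n s t \<longleftrightarrow> t = s + 1 \<or> s = t + 1 \<or> s = 0 \<and> t = n - 1 \<or> t = 0 \<and> s = n - 1"

lemma cyc_adj_shorten:
  assumes "0 \<le> s" "s < n" "0 \<le> t" "t < n" "n \<ge> 7" "s \<noteq> 4" "s \<noteq> 5" "t \<noteq> 4" "t \<noteq> 5"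
  shows "cyc_adj (n - 2) (if s \<ge> 6 then s - 2 else s) (if t \<ge> 6 then t - 2 else t) \<longleftrightarrow>
    cyc_adj n s t \<or> s = 3 \<and> t = 6 \<or> s = 6 \<and> t = 3"
proof -
  have "s \<le> 3 \<or> s \<ge> 6" "t \<le> 3 \<or> t \<ge> 6" using assms by linarith+
  then consider "s \<le> 3" "t \<le> 3" | "s \<le> 3" "t \<ge> 6" | "s \<ge> 6" "t \<le> 3" | "s \<ge> 6" "t \<ge> 6" by blast
  then show ?thesis
    by cases (use assms in \<open>auto simp: cyc_adj_def\<close>)
qed

lemma cyc_adj_12:
  assumes "0 \<le> t" "t < n" "n \<ge> 5"
  shows "cyc_adj n 1 t \<longleftrightarrow> t = 0 \<or> t = 2" "cyc_adj n 2 t \<longleftrightarrow> t = 1 \<or> t = 3"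
  using assms by (auto simp: cyc_adj_def)

lemma cycle_blowup_cyc_adj:
  assumes "g > 0"
  shows "(a, b) \<in> cycle_blowup g V \<tau> \<longleftrightarrow> a \<in> V \<and> b \<in> V \<and> cyc_adj (int g) (\<tau> a mod int g) (\<tau> b mod int g)"
proof -
  have *: "int g dvd \<tau> b - \<tau> a - 1 \<longleftrightarrow> \<tau> b mod int g = \<tau> a mod int g + 1 \<or> \<tau> b mod int g = 0 \<and> \<tau> a mod int g = int g - 1"
    for a b
  proof -
    define s t where st: "s = \<tau> a mod int g" "t = \<tau> b mod int g"
    have r: "0 \<le> s" "s < int g" "0 \<le> t" "t < int g" using assms by (auto simp: st)
    have "int g dvd \<tau> b - \<tau> a - 1 \<longleftrightarrow> int g dvd t - s - 1"
    proof -
      have "\<tau> b - \<tau> a - 1 = (t - s - 1) + int g * (\<tau> b div int g - \<tau> a div int g)"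
        using mult_div_mod_eq[of "int g" "\<tau> a"] mult_div_mod_eq[of "int g" "\<tau> b"]
        by (simp add: st algebra_simps)
      then show ?thesis by (simp only: dvd_add_left_iff dvd_triv_left)
    qed
    also have "\<dots> \<longleftrightarrow> t - s - 1 = 0 \<or> t - s - 1 = - int g" using r by (intro dvd_small_iff) auto
    also have "\<dots> \<longleftrightarrow> t = s + 1 \<or> t = 0 \<and> s = int g - 1" using r by auto
    finally show ?thesis by (simp only: st)
  qed
  show ?thesis unfolding cycle_blowup_def cyc_adj_def using * by auto
qed

lemma class_size_cong:
  assumes "int g dvd i - j"
  shows "class_size g V \<tau> i = class_size g V \<tau> j"
  using dvd_diff_cong[OF assms] by (simp add: class_size_def)

text \<open>On vectors that are constant on classes, the adjacency matrix acts through its quotient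
  on the cycle, with classes weighted by size. For \<open>g \<ge> 3\<close> the two neighbouring
  classes are disjoint.\<close>

lemma sum_neighbours_cycle_blowup:
  fixes h :: "int \<Rightarrow> real"
  assumes V: "finite V" and g: "g \<ge> 3" and v: "v \<in> V"
    and h: "\<And>i j. int g dvd i - j \<Longrightarrow> h i = h j"
  shows "(\<Sum>w\<in>cycle_blowup g V \<tau> `` {v}. h (\<tau> w)) =
    real (class_size g V \<tau> (\<tau> v - 1)) * h (\<tau> v - 1) + real (class_size g V \<tau> (\<tau> v + 1)) * h (\<tau> v + 1)"
proof -
  have cls: "(\<Sum>w\<in>{w \<in> V. int g dvd \<tau> w - i}. h (\<tau> w)) = real (class_size g V \<tau> i) * h i" for i
  proof -
    have "(\<Sum>w\<in>{w \<in> V. int g dvd \<tau> w - i}. h (\<tau> w)) = (\<Sum>w\<in>{w \<in> V. int g dvd \<tau> w - i}. h i)"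
      by (rule sum.cong) (auto intro: h)
    then show ?thesis by (simp add: class_size_def)
  qed
  have "cycle_blowup g V \<tau> `` {v} = {w \<in> V. int g dvd \<tau> w - (\<tau> v - 1)} \<union> {w \<in> V. int g dvd \<tau> w - (\<tau> v + 1)}"
    using v by (auto simp: cycle_blowup_iff algebra_simps)
  moreover have "{w \<in> V. int g dvd \<tau> w - (\<tau> v - 1)} \<inter> {w \<in> V. int g dvd \<tau> w - (\<tau> v + 1)} = {}"
  proof -
    have False if "int g dvd \<tau> w - (\<tau> v - 1)" "int g dvd \<tau> w - (\<tau> v + 1)" for w
      using dvd_diff[OF that] zdvd_imp_le[of "int g" 2] g by simp
    then show ?thesis by blast
  qed
  ultimately show ?thesis using V by (simp add: sum.union_disjoint cls)
qed

definition delete_vertex :: "('a \<times> 'a) set \<Rightarrow> 'a \<Rightarrow> ('a \<times> 'a) set" where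
  "delete_vertex E u = {(a, b) \<in> E. a \<noteq> u \<and> b \<noteq> u}"

lemma graph_on_delete_vertex: "graph_on V E \<Longrightarrow> graph_on V (delete_vertex E u)"
  by (auto simp: graph_on_def delete_vertex_def sym_def irrefl_def)

lemma qform_delete_vertex: "graph_on V E \<Longrightarrow> qform E x = qform (delete_vertex E u) x + 2 * x u * sum x (E `` {u})"
  unfolding delete_vertex_def by (rule qform_remove_vertex)

text \<open>An edge between \<open>u\<close> and \<open>w\<close> belongs to both stars; the last
  term corrects the double count.\<close>

lemma qform_delete_two_vertices:
  assumes G: "graph_on V E" and ne: "u \<noteq> w"
  shows "qform E x = qform (delete_vertex (delete_vertex E u) w) x + 2 * x u * sum x (E `` {u}) + 2 * x w * sum x (E `` {w})
    - (if (u, w) \<in> E then 2 * x u * x w else 0)"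
proof -
  note D = graph_onD[OF G]
  have "delete_vertex E u `` {w} = E `` {w} - {u}" using ne by (auto simp: delete_vertex_def)
  moreover have "sum x (E `` {w} - {u}) = sum x (E `` {w}) - (if (u, w) \<in> E then x u else 0)"
    using D(7,10) by (auto simp: sum_diff1)
  ultimately have "sum x (delete_vertex E u `` {w}) = sum x (E `` {w}) - (if (u, w) \<in> E then x u else 0)"
    by simp
  then have "2 * x w * sum x (delete_vertex E u `` {w}) =
      2 * x w * sum x (E `` {w}) - (if (u, w) \<in> E then 2 * x u * x w else 0)"
    by (cases "(u, w) \<in> E") (simp_all add: right_diff_distrib)
  then show ?thesis
    using qform_delete_vertex[OF G, of x u] qform_delete_vertex[OF graph_on_delete_vertex[OF G, of u], of x w] by linarith
qed

section \<open>The odd girth and the balance of the two classes\<close>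

context extremal_cycle
begin

lemma typing_twins:
  assumes "typing \<tau>" "u \<in> V" "v \<in> V" "dvdg (\<tau> u - \<tau> v)"
  shows "E `` {u} = E `` {v}" "x u = x v"
proof -
  have "dvdg (\<tau> w - \<tau> u - 1) \<longleftrightarrow> dvdg (\<tau> w - \<tau> v - 1)" for w
    using dvd_diff_cong[OF assms(4), of "\<tau> w - 1"] by (simp add: algebra_simps)
  moreover have "dvdg (\<tau> w - \<tau> u + 1) \<longleftrightarrow> dvdg (\<tau> w - \<tau> v + 1)" for w
    using dvd_diff_cong[OF assms(4), of "\<tau> w + 1"] by (simp add: algebra_simps)
  ultimately show *: "E `` {u} = E `` {v}"
    using assms(2,3) by (subst (1 2) typing_cycle_blowup(1)[OF assms(1)]) (auto simp: cycle_blowup_iff)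
  have "lam V E * x u = lam V E * x v" using x_eigen[OF assms(2)] x_eigen[OF assms(3)] * by metis
  moreover have "lam V E \<noteq> 0" using lam_ge_2 by linarith
  ultimately show "x u = x v" by simp
qed

lemma typing_class_nonempty: "typing \<tau> \<Longrightarrow> \<exists>v\<in>V. dvdg (\<tau> v - i)"
  by (simp add: typing_def)

lemma typing_class_unique:
  assumes "typing \<tau>" "u \<in> V" "v \<in> V" "dvdg (\<tau> u - \<tau> v)" "u \<noteq> v"
  shows "dvdg (\<tau> u - 1) \<or> dvdg (\<tau> u - 2)"
  using conjunct1[OF conjunct2[OF conjunct2[OF assms(1)[unfolded typing_def]]]] assms(2-5) by blast

lemma typing_onto:
  assumes "typing \<tau>" "0 \<le> i" "i < int g"
  shows "\<exists>v\<in>V. \<tau> v mod int g = i"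
proof -
  obtain v where "v \<in> V" "dvdg (\<tau> v - i)" using typing_class_nonempty[OF assms(1)] by blast
  then have "\<tau> v mod int g = i mod int g" by (simp add: mod_eq_dvd_iff)
  then show ?thesis using assms(2,3) \<open>v \<in> V\<close> by auto
qed

lemma typing_unique:
  assumes "typing \<tau>" "u \<in> V" "v \<in> V" "\<tau> u mod int g = \<tau> v mod int g" "\<tau> v mod int g \<notin> {1, 2}"
  shows "u = v"
proof (rule ccontr)
  assume "u \<noteq> v"
  then have "dvdg (\<tau> u - 1) \<or> dvdg (\<tau> u - 2)"
    using typing_class_unique[OF assms(1-3)] assms(4) by (simp add: mod_eq_dvd_iff)
  then have "\<tau> u mod int g = 1 mod int g \<or> \<tau> u mod int g = 2 mod int g"
    by (simp add: mod_eq_dvd_iff)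
  then show False using assms(4,5) g5 by auto
qed

text \<open>In a longer cycle, deleting the vertices of types 4 and 5 and joining those of types 3 and 6 keeps the
  odd girth large; the two deleted vertices become clones of \<open>u\<close>, which has larger Perron weight.\<close>

lemma girth_eq: "g = 2 * k + 3"
proof (rule ccontr)
  assume "g \<noteq> 2 * k + 3"
  moreover have "g \<noteq> 2 * k + 4" using odd_g by auto
  ultimately have g_ge: "g \<ge> 2 * k + 5" using g_ge by linarith
  then have g7: "g \<ge> 7" using k1 by linarith
  define n where "n = int g"
  have n7: "n \<ge> 7" using g7 by (simp add: n_def)
  obtain \<tau> where \<tau>: "typing \<tau>" using typing_exists by blast
  define t where "t v = \<tau> v mod n" for v
  have t: "0 \<le> t v" "t v < n" for v using g7 by (auto simp: t_def n_def)
  have adj: "(a, b) \<in> E \<longleftrightarrow> a \<in> V \<and> b \<in> V \<and> cyc_adj n (t a) (t b)" for a b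
    using typing_cycle_blowup(1)[OF \<tau>] cycle_blowup_cyc_adj[of g a b V \<tau>] g5 by (simp add: n_def t_def)
  have onto: "\<exists>v\<in>V. t v = i" if "0 \<le> i" "i < n" for i
    using typing_onto[OF \<tau>, of i] that by (simp add: t_def n_def)
  have uniq: "a = b" if "a \<in> V" "b \<in> V" "t a = t b" "t b \<notin> {1, 2}" for a b
    using typing_unique[OF \<tau>, of a b] that by (simp add: t_def n_def)
  obtain v3 v4 v5 v6 where vV: "v3 \<in> V" "v4 \<in> V" "v5 \<in> V" "v6 \<in> V"
    and tv: "t v3 = 3" "t v4 = 4" "t v5 = 5" "t v6 = 6"
    using onto[of 3] onto[of 4] onto[of 5] onto[of 6] n7 by auto
  have ne: "v4 \<noteq> v5" using tv by auto
  have v_iff: "a = v3 \<longleftrightarrow> t a = 3" "a = v4 \<longleftrightarrow> t a = 4" "a = v5 \<longleftrightarrow> t a = 5" "a = v6 \<longleftrightarrow> t a = 6"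
    if "a \<in> V" for a
    using uniq[OF that vV(1)] uniq[OF that vV(2)] uniq[OF that vV(3)] uniq[OF that vV(4)] tv by auto
  have dvd_t: "dvdg (\<tau> v - i) \<longleftrightarrow> t v = i" if "0 \<le> i" "i < n" for v i
    using that by (simp add: mod_eq_dvd_iff[symmetric] t_def n_def)
  obtain u where u: "u \<in> V" "t u = 1 \<or> t u = 2"
    and xu: "\<And>v. v \<in> V \<Longrightarrow> t v \<noteq> 0 \<Longrightarrow> t v \<noteq> 1 \<Longrightarrow> t v \<noteq> 2 \<Longrightarrow> t v \<noteq> 3 \<Longrightarrow> x v \<le> x u"
    using \<tau> dvd_t[of 0] dvd_t[of 1] dvd_t[of 2] dvd_t[of 3] n7 unfolding typing_def by auto
  define \<tau>' where "\<tau>' v = (if t v = 4 \<or> t v = 5 then t u else if t v \<ge> 6 then t v - 2 else t v)" for v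
  have \<tau>': "0 \<le> \<tau>' v" "\<tau>' v < n - 2" for v using t[of v] u(2) n7 by (auto simp: \<tau>'_def)
  define E' where "E' = cycle_blowup (g - 2) V \<tau>'"
  have n2: "int (g - 2) = n - 2" using g7 by (simp add: n_def)
  have adj': "(a, b) \<in> E' \<longleftrightarrow> a \<in> V \<and> b \<in> V \<and> cyc_adj (n - 2) (\<tau>' a) (\<tau>' b)" for a b
    using cycle_blowup_cyc_adj[of "g - 2" a b V \<tau>'] g7 \<tau>' by (simp add: E'_def n2)
  have adm': "admissible k V E'"
    unfolding E'_def
  proof (rule admissible_cycle_blowup)
    show "finite V" "odd (g - 2)" "g - 2 \<ge> 2 * k + 3" using GD(1) odd_g g_ge by auto
    fix i
    define j where "j = i mod (n - 2)"
    have j: "0 \<le> j" "j < n - 2" using n7 by (auto simp: j_def)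
    obtain v where "v \<in> V" "\<tau>' v = j"
    proof (cases "j \<le> 3")
      case True
      then show ?thesis using onto[of j] j that by (auto simp: \<tau>'_def)
    next
      case False
      then show ?thesis using onto[of "j + 2"] j that by (auto simp: \<tau>'_def)
    qed
    moreover have "int (g - 2) dvd j - i" unfolding n2 by (simp add: j_def mod_eq_dvd_iff[symmetric])
    ultimately show "\<exists>v\<in>V. int (g - 2) dvd \<tau>' v - i" by auto
  qed
  then have G': "graph_on V E'" by (simp add: admissible_def)
  have nb: "E' `` {v4} = E `` {u}" "E' `` {v5} = E `` {u}"
  proof -
    \<comment> \<open>Types 1 and 2 are adjacent only to types 0 to 3, which keep their numbers, and
      no renumbered vertex receives a type adjacent to that of \<open>u\<close>.\<close>
    have c: "cyc_adj (n - 2) (t u) (\<tau>' w) \<longleftrightarrow> cyc_adj n (t u) (t w)" for w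
    proof (cases "t u = 1")
      case True
      then show ?thesis using t[of w] \<tau>'[of w] n7 by (simp add: cyc_adj_12 \<tau>'_def)
    next
      case False
      then have "t u = 2" using u(2) by simp
      then show ?thesis using t[of w] \<tau>'[of w] n7 by (simp add: cyc_adj_12 \<tau>'_def)
    qed
    have "\<tau>' v4 = t u" "\<tau>' v5 = t u" using tv by (simp_all add: \<tau>'_def)
    then show "E' `` {v4} = E `` {u}" "E' `` {v5} = E `` {u}"
      unfolding set_eq_iff Image_singleton_iff adj adj' using c vV u(1) by simp_all
  qed
  have rest: "delete_vertex (delete_vertex E' v4) v5 = delete_vertex (delete_vertex E v4) v5 \<union> {(v3, v6), (v6, v3)}"
  proof -
    have "(a, b) \<in> delete_vertex (delete_vertex E' v4) v5 \<longleftrightarrow> (a, b) \<in> delete_vertex (delete_vertex E v4) v5 \<union> {(v3, v6), (v6, v3)}"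
      for a b
    proof (cases "a \<in> V \<and> b \<in> V")
      case True
      show ?thesis
      proof (cases "t a = 4 \<or> t a = 5 \<or> t b = 4 \<or> t b = 5")
        case bad: True
        then have "{a, b} \<inter> {v4, v5} \<noteq> {}" using True v_iff by blast
        moreover have "{v3, v6} \<inter> {v4, v5} = {}" using tv by auto
        ultimately show ?thesis by (auto simp: delete_vertex_def)
      next
        case False
        then have "cyc_adj (n - 2) (\<tau>' a) (\<tau>' b) \<longleftrightarrow>
            cyc_adj n (t a) (t b) \<or> t a = 3 \<and> t b = 6 \<or> t a = 6 \<and> t b = 3"
          using cyc_adj_shorten[of "t a" n "t b"] t n7 by (simp add: \<tau>'_def)
        then show ?thesis using True False v_iff[of a] v_iff[of b] by (simp add: delete_vertex_def adj adj') blast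
      qed
    next
      case False
      then show ?thesis using vV by (auto simp: delete_vertex_def adj adj')
    qed
    then show ?thesis by auto
  qed
  have "qform (delete_vertex (delete_vertex E' v4) v5) x = qform (delete_vertex (delete_vertex E v4) v5) x + 2 * x v3 * x v6"
  proof -
    have "(v3, v6) \<notin> delete_vertex (delete_vertex E v4) v5" "(v6, v3) \<notin> delete_vertex (delete_vertex E v4) v5" "v3 \<noteq> v6"
      using tv n7 by (auto simp: delete_vertex_def adj cyc_adj_def)
    moreover have "finite (delete_vertex (delete_vertex E v4) v5)"
      using graph_onD(4)[OF graph_on_delete_vertex[OF graph_on_delete_vertex[OF G]]] .
    ultimately show ?thesis unfolding rest qform_def by (subst sum.union_disjoint) auto
  qed
  moreover have "(v4, v5) \<in> E" using vV tv by (simp add: adj cyc_adj_def)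
  moreover have "(v4, v5) \<notin> E'" using vV tv u n7 by (auto simp: adj' cyc_adj_def \<tau>'_def)
  \<comment> \<open>The product \<open>x v3 * x v6\<close> is the new edge. The product
    \<open>x v4 * x v5\<close> appears since the neighbour sums of \<open>E\<close> count the edge
    between \<open>v4\<close> and \<open>v5\<close> twice, while these vertices are not adjacent in
    \<open>E'\<close>.\<close>
  ultimately have diff: "qform E' x = qform E x + 2 * (x v3 * x v6 + x v4 * x v5) +
      2 * x v4 * (lam V E * (x u - x v4)) + 2 * x v5 * (lam V E * (x u - x v5))"
    using qform_delete_two_vertices[OF G ne, of x] qform_delete_two_vertices[OF G' ne, of x] nb x_eigen vV u(1)
    by (simp add: algebra_simps)
  have pos: "x v > 0" if "v \<in> V" for v using typing_cycle_blowup(2)[OF \<tau> that] .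
  have "x v4 \<le> x u" "x v5 \<le> x u" using xu vV tv by auto
  then have "2 * x v4 * (lam V E * (x u - x v4)) \<ge> 0" "2 * x v5 * (lam V E * (x u - x v5)) \<ge> 0"
    using pos[of v4] pos[of v5] vV lam_ge_2 by simp_all
  moreover have "x v3 * x v6 > 0" "x v4 * x v5 > 0" using pos vV by simp_all
  ultimately have "0 < 2 * (x v3 * x v6 + x v4 * x v5) +
      2 * x v4 * (lam V E * (x u - x v4)) + 2 * x v5 * (lam V E * (x u - x v5))"
    by (intro add_pos_nonneg) simp_all
  then have "qform E' x > qform E x" unfolding diff by simp
  then show False using extremal_perron_transfer(3)[OF ext perron adm'] by simp
qed

text \<open>This reflection of the cycle exchanges types 1 and 2, so a bound on class sizes proved
  in one direction holds in both.\<close>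

lemma typing_reflect:
  assumes "typing \<tau>"
  shows "typing (\<lambda>v. 3 - \<tau> v)"
proof -
  have d: "dvdg (3 - \<tau> u - (3 - \<tau> v)) \<longleftrightarrow> dvdg (\<tau> u - \<tau> v)" for u v
    using dvd_diff_commute[of "int g" "\<tau> v" "\<tau> u"] by simp
  have s: "dvdg (3 - \<tau> v - i) \<longleftrightarrow> dvdg (\<tau> v - (3 - i))" for v i
    using dvd_diff_commute[of "int g" "3 - i" "\<tau> v"] by (simp add: algebra_simps)
  have s': "dvdg (3 - \<tau> v) \<longleftrightarrow> dvdg (\<tau> v - 3)" "dvdg (3 - \<tau> v - 1) \<longleftrightarrow> dvdg (\<tau> v - 2)"
    "dvdg (3 - \<tau> v - 2) \<longleftrightarrow> dvdg (\<tau> v - 1)" "dvdg (3 - \<tau> v - 3) \<longleftrightarrow> dvdg (\<tau> v)" for v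
    using s[of v 0] s[of v 1] s[of v 2] s[of v 3] by simp_all
  have b: "cycle_blowup g V (\<lambda>v. 3 - \<tau> v) = cycle_blowup g V \<tau>"
    by (auto simp: cycle_blowup_def)
  note t1 = conjunct1[OF assms[unfolded typing_def]] and t' = conjunct2[OF assms[unfolded typing_def]]
  note t2 = conjunct1[OF t'] and t3 = conjunct1[OF conjunct2[OF t']] and t4 = conjunct2[OF conjunct2[OF t']]
  have o: "\<exists>v\<in>V. dvdg (3 - \<tau> v - i)" for i
    unfolding s by (rule t2[rule_format])
  obtain u where u: "u \<in> V" "dvdg (\<tau> u - 1) \<or> dvdg (\<tau> u - 2)"
    and xu: "\<And>v. v \<in> V \<Longrightarrow> \<not> dvdg (\<tau> v) \<Longrightarrow> \<not> dvdg (\<tau> v - 1) \<Longrightarrow> \<not> dvdg (\<tau> v - 2) \<Longrightarrow>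
      \<not> dvdg (\<tau> v - 3) \<Longrightarrow> x v \<le> x u"
    using t4 by blast
  show ?thesis
    unfolding typing_def b s' d
  proof (intro conjI allI ballI impI)
    show "E \<subseteq> cycle_blowup g V \<tau>" by (rule t1)
    show "\<exists>v\<in>V. dvdg (3 - \<tau> v - i)" for i by (rule o)
    show "dvdg (\<tau> u - 2) \<or> dvdg (\<tau> u - 1)"
      if "u \<in> V" "v \<in> V" "dvdg (\<tau> u - \<tau> v) \<and> u \<noteq> v" for u v
      using t3[rule_format, OF that] by blast
    show "\<exists>u\<in>V. (dvdg (\<tau> u - 2) \<or> dvdg (\<tau> u - 1)) \<and>
      (\<forall>v\<in>V. \<not> dvdg (\<tau> v - 3) \<and> \<not> dvdg (\<tau> v - 2) \<and> \<not> dvdg (\<tau> v - 1) \<and> \<not> dvdg (\<tau> v) \<longrightarrow> x v \<le> x u)"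
    proof (intro bexI[of _ u] conjI ballI impI)
      show "dvdg (\<tau> u - 2) \<or> dvdg (\<tau> u - 1)" using u(2) by blast
      show "x v \<le> x u"
        if "v \<in> V" "\<not> dvdg (\<tau> v - 3) \<and> \<not> dvdg (\<tau> v - 2) \<and> \<not> dvdg (\<tau> v - 1) \<and> \<not> dvdg (\<tau> v)" for v
        using xu[OF that(1)] that(2) by blast
    qed (rule u(1))
  qed
qed

lemma not_dvd_less: "r \<noteq> 0 \<Longrightarrow> \<bar>r\<bar> < int g \<Longrightarrow> \<not> dvdg r"
  using zdvd_imp_le[of "int g" "\<bar>r\<bar>"] by auto

text \<open>Otherwise move a vertex \<open>y0\<close> from class 2, of size \<open>p\<close>, to class 1, of size \<open>q\<close>. With \<open>X j\<close> the Perron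
  weight of the vertices of type \<open>j\<close>, the test vector \<open>H j = (p - q - 1) X j + X (3 - j)\<close> satisfies
  \<open>A' H \<ge> \<lambda>\<^sub>1 H\<close> with strict inequality next to class 1, provided that \<open>X 1 > X 2\<close>. The latter holds since
  otherwise the differences of the weights at mirror positions of the long path would be negative and
  decreasing towards its middle, where the difference is 0.\<close>

lemma class_sizes_near:
  assumes \<tau>: "typing \<tau>"
  shows "class_size g V \<tau> 2 \<le> class_size g V \<tau> 1 + 1"
proof (rule ccontr)
  let ?l = "lam V E"
  define m where "m = class_size g V \<tau>"
  define p q where "p = m 2" and "q = m 1"
  assume "\<not> class_size g V \<tau> 2 \<le> class_size g V \<tau> 1 + 1"
  then have pq: "p \<ge> q + 2" by (simp add: p_def q_def m_def)
  have g: "g = 2 * k + 3" by (rule girth_eq)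
  have l2: "?l \<ge> 2" by (rule lam_ge_2)
  have E_eq: "E = cycle_blowup g V \<tau>" by (rule typing_cycle_blowup(1)[OF \<tau>])
  have xpos: "x v > 0" if "v \<in> V" for v using typing_cycle_blowup(2)[OF \<tau> that] .
  have onto: "\<exists>v\<in>V. dvdg (\<tau> v - i)" for i using typing_class_nonempty[OF \<tau>] .
  define X where "X j = x (SOME v. v \<in> V \<and> dvdg (\<tau> v - j))" for j
  have X: "X j = x v" if "v \<in> V" "dvdg (\<tau> v - j)" for v j
  proof -
    define w where "w = (SOME v. v \<in> V \<and> dvdg (\<tau> v - j))"
    have w: "w \<in> V \<and> dvdg (\<tau> w - j)" unfolding w_def by (rule someI_ex) (use that in blast)
    have "dvdg (\<tau> w - \<tau> v)" using dvd_diff[of "int g" "\<tau> w - j" "\<tau> v - j"] w that(2) by simp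
    then show ?thesis using typing_twins(2)[OF \<tau>, of w v] w that(1) by (simp add: X_def w_def)
  qed
  have X_pos: "X j > 0" for j using onto[of j] X xpos by metis
  have X_cong: "X i = X j" if "dvdg (i - j)" for i j
    using dvd_diff_cong[OF that] by (simp add: X_def)
  have m_cong: "m i = m j" if "dvdg (i - j)" for i j
    using class_size_cong[OF that] by (simp add: m_def)
  have eig: "?l * X j = m (j - 1) * X (j - 1) + m (j + 1) * X (j + 1)" for j
  proof -
    obtain v where v: "v \<in> V" "dvdg (\<tau> v - j)" using onto by blast
    have "?l * X j = sum x (E `` {v})" using x_eigen[OF v(1)] X[OF v] by simp
    also have "\<dots> = (\<Sum>w\<in>E `` {v}. X (\<tau> w))"
    proof (rule sum.cong)
      fix w assume "w \<in> E `` {v}"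
      then have "w \<in> V" using GD(11) by blast
      then show "x w = X (\<tau> w)" using X[of w "\<tau> w"] by simp
    qed simp
    also have "\<dots> = m (\<tau> v - 1) * X (\<tau> v - 1) + m (\<tau> v + 1) * X (\<tau> v + 1)"
      using sum_neighbours_cycle_blowup[of V g v X \<tau>] GD(1) g5 v(1) X_cong by (simp add: E_eq[symmetric] m_def)
    finally have *: "?l * X j = m (\<tau> v - 1) * X (\<tau> v - 1) + m (\<tau> v + 1) * X (\<tau> v + 1)" .
    have "m (\<tau> v - 1) = m (j - 1)" "m (\<tau> v + 1) = m (j + 1)"
      using v(2) by (intro m_cong; simp)+
    moreover have "X (\<tau> v - 1) = X (j - 1)" "X (\<tau> v + 1) = X (j + 1)"
      using v(2) by (intro X_cong; simp)+
    ultimately show ?thesis using * by simp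
  qed
  have m1: "m i = 1" if nd: "\<not> dvdg (i - 1)" "\<not> dvdg (i - 2)" for i
  proof -
    obtain v where v: "v \<in> V" "dvdg (\<tau> v - i)" using onto by blast
    have "w = v" if w: "w \<in> V" "dvdg (\<tau> w - i)" for w
    proof (rule ccontr)
      assume "w \<noteq> v"
      moreover have "dvdg (\<tau> w - \<tau> v)" using dvd_diff[OF w(2) v(2)] by simp
      ultimately have "dvdg (\<tau> w - 1) \<or> dvdg (\<tau> w - 2)"
        using typing_class_unique[OF \<tau> w(1) v(1)] by blast
      then show False using dvd_diff[of "int g" "\<tau> w - 1" "\<tau> w - i"] dvd_diff[of "int g" "\<tau> w - 2" "\<tau> w - i"]
          w(2) nd by auto
    qed
    then have "{w \<in> V. dvdg (\<tau> w - i)} = {v}" using v by blast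
    then show ?thesis by (simp add: m_def class_size_def)
  qed
  have g5': "int g \<ge> 5" using g5 by simp
  have m1s: "m (- 1) = 1" "m 0 = 1" "m 3 = 1" "m 4 = 1"
    using m1[of "- 1"] m1[of 0] m1[of 3] m1[of 4]
      not_dvd_less[of 1] not_dvd_less[of 2] not_dvd_less[of 3] not_dvd_less[of "- 1"]
      not_dvd_less[of "- 2"] not_dvd_less[of "- 3"] g5' by simp_all
  have e: "?l * X 2 = q * X 1 + X 3" "?l * X 1 = X 0 + p * X 2"
    "?l * X 0 = X (- 1) + q * X 1" "?l * X 3 = p * X 2 + X 4"
    using eig[of 2] eig[of 1] eig[of 0] eig[of 3] m1s by (simp_all add: p_def q_def)
  have X12: "X 1 > X 2"
  proof (rule ccontr)
    assume "\<not> X 1 > X 2"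
    then have le: "X 1 \<le> X 2" by simp
    \<comment> \<open>The positions \<open>- i\<close> and \<open>3 + i\<close> run inwards from the
      ends of the path, types 0 and 3.\<close>
    define d where "d i = X (- int i) - X (3 + int i)" for i
    have "?l * X 1 \<le> ?l * X 2" using le l2 by (intro mult_left_mono) auto
    then have d0: "d 0 \<le> q * X 1 - p * X 2" unfolding e d_def by simp
    have "q * X 1 \<le> q * X 2" using le by (intro mult_left_mono) auto
    also have "\<dots> < p * X 2" using pq X_pos by simp
    finally have neg: "d 0 < 0" using d0 by simp
    \<comment> \<open>At the ends of the path the recursion has a boundary term, which is at least
      \<open>d 0\<close>; hence the bound on \<open>d 1\<close>.\<close>
    have "?l * d 0 - d 1 = q * X 1 - p * X 2"
      using e(3,4) by (simp add: d_def algebra_simps)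
    then have d1: "d 1 \<le> (?l - 1) * d 0" using d0 by (simp add: algebra_simps)
    have l0: "(?l - 2) * y \<le> 0" if "y < 0" for y :: real
      using that l2 by (intro mult_nonneg_nonpos) auto
    have "d 1 \<le> d 0" using d1 l0[OF neg] by (simp add: algebra_simps)
    have rec: "d (i + 2) = ?l * d (i + 1) - d i" if i: "i + 2 \<le> 2 * k" for i
    proof -
      let ?i = "int i"
      have nd: "\<not> dvdg (- ?i - 2 - 1)" "\<not> dvdg (- ?i - 2 - 2)"
          "\<not> dvdg (3 + ?i - 1)" "\<not> dvdg (3 + ?i - 2)" "\<not> dvdg (5 + ?i - 1)" "\<not> dvdg (5 + ?i - 2)"
          "\<not> dvdg (- ?i - 1)" "\<not> dvdg (- ?i - 2)"
        by (rule not_dvd_less; use i g in linarith)+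
      have "m (- ?i - 2) = 1" "m (- ?i) = 1" "m (3 + ?i) = 1" "m (5 + ?i) = 1"
        using m1[OF nd(1,2)] m1[OF nd(7,8)] m1[OF nd(3,4)] m1[OF nd(5,6)] by simp_all
      then have "?l * X (- ?i - 1) = X (- ?i - 2) + X (- ?i)" "?l * X (4 + ?i) = X (3 + ?i) + X (5 + ?i)"
        using eig[of "- ?i - 1"] eig[of "4 + ?i"] by (simp_all add: algebra_simps)
      moreover have "- int (i + 1) = - ?i - 1" "3 + int (i + 1) = 4 + ?i"
        "- int (i + 2) = - ?i - 2" "3 + int (i + 2) = 5 + ?i" by simp_all
      ultimately show ?thesis unfolding d_def by (simp only: right_diff_distrib)
    qed
    have "d (i + 1) \<le> d i \<and> d i < 0" if "i < k" for i
      using that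
    proof (induction i)
      case 0
      then show ?case using neg \<open>d 1 \<le> d 0\<close> by simp
    next
      case (Suc i)
      then have IH: "d (i + 1) \<le> d i" "d i < 0" by auto
      then have "d (i + 1) < 0" by linarith
      \<comment> \<open>As \<open>lam V E \<ge> 2\<close>, the sequence is concave where it is
        negative, so it keeps decreasing.\<close>
      moreover have "d (i + 2) - d (i + 1) = (?l - 2) * d (i + 1) + (d (i + 1) - d i)"
        using rec[of i] Suc.prems by (simp add: algebra_simps)
      then have "d (i + 2) \<le> d (i + 1)" using l0[OF \<open>d (i + 1) < 0\<close>] IH(1) by linarith
      ultimately show ?case by simp
    qed
    from this[of "k - 1"] have "d k < 0" using k1 by simp
    \<comment> \<open>With \<open>g = 2 * k + 3\<close> the mirror positions meet after
      \<open>k\<close> steps: both are the same type modulo \<open>g\<close>.\<close>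
    moreover have "X (- int k) = X (3 + int k)"
    proof (rule X_cong)
      have "- int k - (3 + int k) = - int g" by (simp add: g)
      then show "dvdg (- int k - (3 + int k))" by (simp only: dvd_minus_iff dvd_refl)
    qed
    ultimately show False by (simp add: d_def)
  qed
  obtain y0 where y0: "y0 \<in> V" "dvdg (\<tau> y0 - 2)" using onto by blast
  define \<tau>' where "\<tau>' = \<tau>(y0 := 1)"
  define m' where "m' = class_size g V \<tau>'"
  have nd12: "\<not> dvdg 1" "\<not> dvdg (- 1)" using not_dvd_less[of 1] not_dvd_less[of "- 1"] g5' by auto
  have fin: "finite {w \<in> V. dvdg (\<tau> w - i)}" for i using GD(1) by simp
  have m'_cong: "m' i = m' j" if "dvdg (i - j)" for i j
    using class_size_cong[OF that] by (simp add: m'_def)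
  have y01: "\<not> dvdg (\<tau> y0 - 1)" using dvd_diff[of "int g" "\<tau> y0 - 1" "\<tau> y0 - 2"] y0(2) nd12 by auto
  have m'1: "m' 1 = q + 1"
  proof -
    have "{w \<in> V. dvdg (\<tau>' w - 1)} = insert y0 {w \<in> V. dvdg (\<tau> w - 1)}"
      using y0(1) by (auto simp: \<tau>'_def)
    then show ?thesis using fin y01 by (simp add: m'_def m_def q_def class_size_def)
  qed
  have m'2: "m' 2 = p - 1"
  proof -
    have "{w \<in> V. dvdg (\<tau>' w - 2)} = {w \<in> V. dvdg (\<tau> w - 2)} - {y0}"
      using nd12 by (auto simp: \<tau>'_def)
    then show ?thesis using fin y0 by (simp add: m'_def m_def p_def class_size_def)
  qed
  have m'_other: "m' i = 1" if "\<not> dvdg (i - 1)" "\<not> dvdg (i - 2)" for i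
  proof -
    have "\<not> dvdg (1 - i)" using that(1) dvd_diff_commute by blast
    moreover have "\<not> dvdg (\<tau> y0 - i)"
      using that(2) dvd_diff[of "int g" "\<tau> y0 - 2" "\<tau> y0 - i"] y0(2) by auto
    ultimately have "{w \<in> V. dvdg (\<tau>' w - i)} = {w \<in> V. dvdg (\<tau> w - i)}"
      by (auto simp: \<tau>'_def)
    then show ?thesis using m1[OF that] by (simp add: m'_def m_def class_size_def)
  qed
  define E' where "E' = cycle_blowup g V \<tau>'"
  have adm': "admissible k V E'"
    unfolding E'_def
  proof (rule admissible_cycle_blowup[OF GD(1) odd_g g_ge])
    fix i
    have "m' i \<noteq> 0"
      using m'_other[of i] m'_cong[of i 1] m'_cong[of i 2] m'1 m'2 pq by linarith
    then have "{w \<in> V. dvdg (\<tau>' w - i)} \<noteq> {}" unfolding m'_def class_size_def by (metis card.empty)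
    then show "\<exists>v\<in>V. dvdg (\<tau>' v - i)" by blast
  qed
  then have G': "graph_on V E'" by (simp add: admissible_def)
  \<comment> \<open>The coefficient for which both classes of changed size gain exactly
    \<open>s * (X 1 - X 2)\<close>. The assumed gap of 2 gives \<open>s \<ge> 1\<close>.\<close>
  define s where "s = real p - real q - 1"
  have s1: "s \<ge> 1" using pq by (simp add: s_def)
  define H where "H j = s * X j + X (3 - j)" for j
  have H_cong: "H i = H j" if "dvdg (i - j)" for i j
  proof -
    have "dvdg (3 - i - (3 - j))" using that dvd_diff_commute[of "int g" j i] by simp
    then show ?thesis using X_cong[OF that] X_cong[of "3 - i" "3 - j"] by (simp add: H_def)
  qed
  have H_pos: "H j > 0" for j
    using s1 X_pos[of j] X_pos[of "3 - j"] by (simp add: H_def add_pos_pos)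
  have gain: "m' i * H i \<ge> s * (m i * X i) + m (3 - i) * X (3 - i)"
    and gain1: "dvdg (i - 1) \<Longrightarrow> m' i * H i > s * (m i * X i) + m (3 - i) * X (3 - i)" for i
  proof -
    have pos: "s * (X 1 - X 2) > 0" using s1 X12 by simp
    have c1: "m' i * H i = s * (m i * X i) + m (3 - i) * X (3 - i) + s * (X 1 - X 2)" if "dvdg (i - 1)"
    proof -
      have "dvdg (3 - i - 2)" using that dvd_diff_commute[of "int g" 1 i] by simp
      then have "m i = q" "m (3 - i) = p" "X i = X 1" "X (3 - i) = X 2" "m' i = q + 1" "H i = H 1"
        using m_cong[OF that] X_cong[OF that] m_cong[of "3 - i" 2] X_cong[of "3 - i" 2] H_cong[OF that]
          m'_cong[OF that] m'1 by (simp_all add: p_def q_def)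
      then show ?thesis by (simp add: H_def s_def algebra_simps)
    qed
    have c2: "m' i * H i = s * (m i * X i) + m (3 - i) * X (3 - i) + s * (X 1 - X 2)" if "dvdg (i - 2)"
    proof -
      have "dvdg (3 - i - 1)" using that dvd_diff_commute[of "int g" 2 i] by simp
      then have f: "m i = p" "m (3 - i) = q" "X i = X 2" "X (3 - i) = X 1" "real (m' i) = real p - 1"
        using m_cong[OF that] X_cong[OF that] m_cong[of "3 - i" 1] X_cong[of "3 - i" 1] 
          m'_cong[OF that] m'2 pq by (simp_all add: p_def q_def of_nat_diff)
      show ?thesis unfolding H_def f by (simp add: s_def algebra_simps)
    qed
    have c3: "m' i * H i = s * (m i * X i) + m (3 - i) * X (3 - i)" if "\<not> dvdg (i - 1)" "\<not> dvdg (i - 2)"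
    proof -
      have "\<not> dvdg (3 - i - 1)" "\<not> dvdg (3 - i - 2)"
        using that dvd_diff_commute[of "int g" 2 i] dvd_diff_commute[of "int g" 1 i] by simp_all
      then show ?thesis using m1[OF that] m'_other[OF that] m1[of "3 - i"] by (simp add: H_def)
    qed
    show "m' i * H i \<ge> s * (m i * X i) + m (3 - i) * X (3 - i)" using c1 c2 c3 pos by linarith
    show "dvdg (i - 1) \<Longrightarrow> m' i * H i > s * (m i * X i) + m (3 - i) * X (3 - i)" using c1 pos by linarith
  qed
  define y where "y v = H (\<tau>' v)" for v
  have ysum: "sum y (E' `` {v}) = m' (\<tau>' v - 1) * H (\<tau>' v - 1) + m' (\<tau>' v + 1) * H (\<tau>' v + 1)"
    if "v \<in> V" for v
    using sum_neighbours_cycle_blowup[of V g v H \<tau>'] GD(1) g5 that H_cong by (simp add: E'_def y_def m'_def)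
  have ly: "?l * H j = (s * (m (j - 1) * X (j - 1)) + m (3 - (j - 1)) * X (3 - (j - 1))) +
     (s * (m (j + 1) * X (j + 1)) + m (3 - (j + 1)) * X (3 - (j + 1)))" for j
  proof -
    have "3 - (j - 1) = (3 - j) + 1" "3 - (j + 1) = (3 - j) - 1" by simp_all
    then have "?l * X (3 - j) = m (3 - (j + 1)) * X (3 - (j + 1)) + m (3 - (j - 1)) * X (3 - (j - 1))"
      using eig[of "3 - j"] by simp
    moreover have "?l * H j = s * (?l * X j) + ?l * X (3 - j)" by (simp add: H_def algebra_simps)
    ultimately show ?thesis unfolding eig[of j] by (simp add: distrib_left)
  qed
  have ge: "?l * y v \<le> sum y (E' `` {v})" if "v \<in> V" for v
    unfolding ysum[OF that] unfolding y_def ly using gain[of "\<tau>' v - 1"] gain[of "\<tau>' v + 1"] by linarith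
  \<comment> \<open>Type 0 is next to class 1, where the gain is strict; this makes one of the
    inequalities strict.\<close>
  obtain v0 where v0: "v0 \<in> V" "dvdg (\<tau>' v0 - 0)"
  proof -
    obtain v where v: "v \<in> V" "dvdg (\<tau> v - 0)" using onto by blast
    then have "v \<noteq> y0" using y0(2) dvd_diff[of "int g" "\<tau> v - 0" "\<tau> v - 2"] not_dvd_less[of 2] g5' by auto
    then show ?thesis using that[of v] v by (simp add: \<tau>'_def)
  qed
  have gt: "?l * y v0 < sum y (E' `` {v0})"
    unfolding ysum[OF v0(1)] unfolding y_def ly
    using gain[of "\<tau>' v0 - 1"] gain1[of "\<tau>' v0 + 1"] v0(2) by (simp add: algebra_simps)
  have ypos: "y v > 0" for v by (simp add: y_def H_pos)
  have "?l * sqnorm V y = (\<Sum>v\<in>V. y v * (?l * y v))"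
    unfolding sqnorm_def sum_distrib_left by (rule sum.cong) (simp_all add: power2_eq_square)
  also have "\<dots> < (\<Sum>v\<in>V. y v * sum y (E' `` {v}))"
    by (rule sum_strict_mono_ex1)
      (use GD(1) ge gt v0(1) ypos in \<open>auto intro!: mult_left_mono simp: less_imp_le\<close>)
  also have "\<dots> = qform E' y" by (rule qform_eq_sum_neighbours[OF G', symmetric])
  also have "\<dots> \<le> lam V E' * sqnorm V y" by (rule lam_rayleigh(1)[OF G'])
  also have "\<dots> \<le> ?l * sqnorm V y"
    using ext adm' sqnorm_nonneg by (intro mult_right_mono) (auto simp: extremal_def)
  finally show False by simp
qed

end

section \<open>The graphs \<open>R\<^sub>k(K\<^sub>s\<^sub>,\<^sub>t)\<close>\<close>

text \<open>Arcs are pairs, with the projections as tail and head, so the arc map of an isomorphism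
  is determined by its vertex map.\<close>

lemma digraph_iso_with_proj_iff:
  assumes "pair_graph G"
  shows "digraph_iso (with_proj G) (with_proj H) \<longleftrightarrow>
    (\<exists>h. inj_on h (pverts G) \<and> pverts H = h ` pverts G \<and> parcs H = map_prod h h ` parcs G)"
proof
  interpret pair_graph G by (rule assms)
  assume "digraph_iso (with_proj G) (with_proj H)"
  then obtain f where f: "digraph_isomorphism f" and H: "with_proj H = app_iso f (with_proj G)"
    unfolding digraph_iso_def by blast
  have V: "pverts H = iso_verts f ` pverts G" and A: "parcs H = iso_arcs f ` parcs G"
    and T: "fst = iso_tail f" and S: "snd = iso_head f"
    using arg_cong[OF H, of verts] arg_cong[OF H, of arcs] arg_cong[OF H, of tail] arg_cong[OF H, of head]
    by simp_all
  have "iso_arcs f e = map_prod (iso_verts f) (iso_verts f) e" if "e \<in> parcs G" for e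
    using f that unfolding digraph_isomorphism_def T[symmetric] S[symmetric]
    by (auto intro!: prod_eqI)
  then have "parcs H = map_prod (iso_verts f) (iso_verts f) ` parcs G"
    unfolding A by (intro image_cong) auto
  moreover have "inj_on (iso_verts f) (pverts G)" using f by (simp add: digraph_isomorphism_def)
  ultimately show "\<exists>h. inj_on h (pverts G) \<and> pverts H = h ` pverts G \<and> parcs H = map_prod h h ` parcs G"
    using V by blast
next
  interpret pair_graph G by (rule assms)
  assume "\<exists>h. inj_on h (pverts G) \<and> pverts H = h ` pverts G \<and> parcs H = map_prod h h ` parcs G"
  then obtain h where h: "inj_on h (pverts G)" "pverts H = h ` pverts G" "parcs H = map_prod h h ` parcs G"
    by blast
  let ?f = "\<lparr>iso_verts = h, iso_arcs = map_prod h h, iso_head = snd, iso_tail = fst\<rparr>"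
  have "parcs G \<subseteq> pverts G \<times> pverts G" using arc_fst_in_verts arc_snd_in_verts by force
  then have "inj_on (map_prod h h) (parcs G)"
    using map_prod_inj_on[OF h(1) h(1)] inj_on_subset by blast
  then have "digraph_isomorphism ?f"
    using h(1) wf_digraph_axioms by (simp add: digraph_isomorphism_def)
  moreover have "with_proj H = app_iso ?f (with_proj G)"
    using h by (simp add: app_iso_def with_proj_def)
  ultimately show "digraph_iso (with_proj G) (with_proj H)" unfolding digraph_iso_def by blast
qed

lemma graph_on_image:
  assumes "graph_on V E" "inj_on h V"
  shows "graph_on (h ` V) (map_prod h h ` E)"
proof -
  note D = graph_onD[OF assms(1)]
  have "irrefl (map_prod h h ` E)"
    unfolding irrefl_def using D(8,9) assms(2) by (auto dest: inj_onD)
  moreover have "sym (map_prod h h ` E)" unfolding sym_def using D(7) by force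
  ultimately show ?thesis using D(1,2,3) by (auto simp: graph_on_def)
qed

lemma lam_image:
  assumes G: "graph_on V E" and h: "inj_on h V"
  shows "lam (h ` V) (map_prod h h ` E) = lam V E"
proof -
  note D = graph_onD[OF G]
  note G' = graph_on_image[OF G h]
  have nb: "(map_prod h h ` E) `` {h v} = h ` (E `` {v})" if "v \<in> V" for v
    using that D(9) h by (force dest: inj_onD)
  have s: "sum f ((map_prod h h ` E) `` {h v}) = sum (\<lambda>w. f (h w)) (E `` {v})"
    if "v \<in> V" for v and f :: "_ \<Rightarrow> real"
    unfolding nb[OF that] using inj_on_subset[OF h D(11)] by (simp add: sum.reindex)
  have "\<theta> \<in> graph_eigenvalues \<lparr>pverts = h ` V, parcs = map_prod h h ` E\<rparr> \<longleftrightarrow>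
      \<theta> \<in> graph_eigenvalues \<lparr>pverts = V, parcs = E\<rparr>" for \<theta>
  proof
    assume "\<theta> \<in> graph_eigenvalues \<lparr>pverts = h ` V, parcs = map_prod h h ` E\<rparr>"
    then obtain f where f: "\<exists>v\<in>V. f (h v) \<noteq> 0"
        "\<forall>v\<in>V. sum f ((map_prod h h ` E) `` {h v}) = \<theta> * f (h v)"
      unfolding graph_eigenvalues_iff[OF G'] by blast
    then show "\<theta> \<in> graph_eigenvalues \<lparr>pverts = V, parcs = E\<rparr>"
      unfolding graph_eigenvalues_iff[OF G] using s by (intro exI[of _ "\<lambda>v. f (h v)"]) simp
  next
    assume "\<theta> \<in> graph_eigenvalues \<lparr>pverts = V, parcs = E\<rparr>"
    then obtain f where f: "\<exists>v\<in>V. f v \<noteq> 0" "\<And>v. v \<in> V \<Longrightarrow> sum f (E `` {v}) = \<theta> * f v"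
      unfolding graph_eigenvalues_iff[OF G] by blast
    define f' where "f' w = f (the_inv_into V h w)" for w
    have f': "f' (h v) = f v" if "v \<in> V" for v using that h by (simp add: f'_def the_inv_into_f_f)
    have "sum f' ((map_prod h h ` E) `` {h v}) = \<theta> * f' (h v)" if "v \<in> V" for v
    proof -
      have "(\<Sum>w\<in>E `` {v}. f' (h w)) = sum f (E `` {v})"
        by (rule sum.cong) (use f' D(9) in auto)
      then show ?thesis using s[OF that] f(2)[OF that] f'[OF that] by simp
    qed
    moreover have "\<exists>v\<in>V. f' (h v) \<noteq> 0" using f(1) f' by auto
    ultimately show "\<theta> \<in> graph_eigenvalues \<lparr>pverts = h ` V, parcs = map_prod h h ` E\<rparr>"
      unfolding graph_eigenvalues_iff[OF G'] by blast
  qed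
  then have "graph_eigenvalues \<lparr>pverts = h ` V, parcs = map_prod h h ` E\<rparr> =
      graph_eigenvalues \<lparr>pverts = V, parcs = E\<rparr>" by blast
  then show ?thesis by (simp add: lambda1_def)
qed

text \<open>Adjacency depends only on types modulo \<open>g\<close>, so bijections between
  corresponding classes, chosen independently, glue to an isomorphism.\<close>

lemma cycle_blowup_isomorphic:
  assumes V: "finite V" "finite V'" and g: "g > 0"
    and c: "\<And>i. 0 \<le> i \<Longrightarrow> i < int g \<Longrightarrow> class_size g V \<tau> i = class_size g V' \<tau>' i"
  shows "\<exists>h. inj_on h V \<and> V' = h ` V \<and> cycle_blowup g V' \<tau>' = map_prod h h ` cycle_blowup g V \<tau>"
proof -
  define C where "C i = {v \<in> V. int g dvd \<tau> v - i}" for i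
  define C' where "C' i = {v \<in> V'. int g dvd \<tau>' v - i}" for i
  have "\<exists>b. bij_betw b (C (v mod int g)) (C' (v mod int g))" for v
    by (rule finite_same_card_bij) (use V g c[of "v mod int g"] in \<open>auto simp: C_def C'_def class_size_def\<close>)
  then obtain b where b: "\<And>v. bij_betw (b v) (C (v mod int g)) (C' (v mod int g))" by metis
  define h where "h v = b (\<tau> v mod int g) v" for v
  have mem: "v \<in> C (\<tau> v mod int g)" if "v \<in> V" for v
    using that by (simp add: C_def mod_eq_dvd_iff[symmetric])
  have mem': "v \<in> C' (\<tau>' v mod int g)" if "v \<in> V'" for v
    using that by (simp add: C'_def mod_eq_dvd_iff[symmetric])
  have h: "h v \<in> V' \<and> \<tau>' (h v) mod int g = \<tau> v mod int g" if "v \<in> V" for v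
  proof -
    have "h v \<in> C' (\<tau> v mod int g)"
      using bij_betwE[OF b[of "\<tau> v mod int g"]] mem[OF that] by (simp add: h_def)
    then show ?thesis by (simp add: C'_def mod_eq_dvd_iff[symmetric])
  qed
  have inj: "inj_on h V"
  proof (rule inj_onI)
    fix v w assume vw: "v \<in> V" "w \<in> V" "h v = h w"
    then have eq: "\<tau> v mod int g = \<tau> w mod int g" using h by metis
    have "inj_on (b (\<tau> v mod int g)) (C (\<tau> v mod int g))"
      using bij_betw_imp_inj_on[OF b[of "\<tau> v mod int g"]] by simp
    moreover have "b (\<tau> v mod int g) v = b (\<tau> v mod int g) w" using vw(3) eq by (simp add: h_def)
    ultimately show "v = w" using mem[OF vw(1)] mem[OF vw(2)] eq by (auto dest: inj_onD)
  qed
  have surj: "V' \<subseteq> h ` V"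
  proof
    fix w assume w: "w \<in> V'"
    define r where "r = \<tau>' w mod int g"
    have "w \<in> b r ` C r"
      using bij_betw_imp_surj_on[OF b[of r]] mem'[OF w] by (simp add: r_def)
    then obtain v where v: "v \<in> C r" "w = b r v" by blast
    have "\<tau> v mod int g = r mod int g" using v(1) by (simp add: C_def mod_eq_dvd_iff)
    then have "v \<in> V" "\<tau> v mod int g = r" using v(1) by (simp_all add: C_def r_def)
    then show "w \<in> h ` V" using v by (auto simp: h_def)
  qed
  have V': "V' = h ` V" using surj h by blast
  have adj: "(h u, h v) \<in> cycle_blowup g V' \<tau>' \<longleftrightarrow> (u, v) \<in> cycle_blowup g V \<tau>" if "u \<in> V" "v \<in> V" for u v
    using h[OF that(1)] h[OF that(2)] that by (simp add: cycle_blowup_cyc_adj[OF g])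
  have "(h u, h v) \<in> cycle_blowup g V' \<tau>'" if "(u, v) \<in> cycle_blowup g V \<tau>" for u v
  proof -
    have "u \<in> V" "v \<in> V" using that by (auto simp: cycle_blowup_def)
    then show ?thesis using adj that by blast
  qed
  moreover have "e \<in> map_prod h h ` cycle_blowup g V \<tau>" if e: "e \<in> cycle_blowup g V' \<tau>'" for e
  proof -
    obtain u' v' where e': "e = (u', v')" "u' \<in> V'" "v' \<in> V'" using e by (auto simp: cycle_blowup_def)
    then obtain u v where "u \<in> V" "v \<in> V" "u' = h u" "v' = h v" using V' by blast
    then show ?thesis using e e' adj by force
  qed
  ultimately have "cycle_blowup g V' \<tau>' = map_prod h h ` cycle_blowup g V \<tau>" by auto
  then show ?thesis using inj V' by blast
qed

text \<open>The ends 0 and \<open>s\<close> of the replaced edge have types 0 and 3; the rest of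
  their parts form the classes 2 and 1. Along the new path the type falls from
  \<open>2 * k + 2\<close>, which is -1 modulo \<open>2 * k + 3\<close>, to 4.\<close>

definition R_type :: "nat \<Rightarrow> nat \<Rightarrow> nat \<Rightarrow> nat \<Rightarrow> int" where
  "R_type k s t i = (if i = 0 then 0 else if i < s then 2 else if i = s then 3 else if i < s + t then 1
     else 2 * int k + 2 + int s + int t - int i)"

lemma R_graph_eq_cycle_blowup:
  assumes s: "s \<ge> 1" and t: "t \<ge> 1" and k: "k \<ge> 1"
  shows "R_graph k s t = \<lparr>pverts = {0..<s + t + 2 * k - 1},
    parcs = cycle_blowup (2 * k + 3) {0..<s + t + 2 * k - 1} (R_type k s t)\<rparr>"
proof -
  define N where "N = s + t + 2 * k - 1"
  have N: "N = s + t + (2 * k - 1)" "N - 1 = s + t + 2 * k - 2" "s + t < N" using k by (auto simp: N_def)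
  have V: "pverts (R_graph k s t) = {0..<N}"
    using k by (auto simp: N_def R_graph_def replace_edge_by_path_def complete_bipartite_graph_def)
  have E: "parcs (R_graph k s t) = (symcl ({0..<s} \<times> {s..<s + t}) - {(0, s), (s, 0)}) \<union>
     symcl ({(0, s + t), (N - 1, s)} \<union> {(i, Suc i) | i. s + t \<le> i \<and> Suc i < N})"
    unfolding R_graph_def replace_edge_by_path_def complete_bipartite_graph_def
      set_vwalk_arcs_upt N_def[symmetric] using N(3) by simp
  define adj where "adj a b \<longleftrightarrow> a < s \<and> s \<le> b \<and> b < s + t \<and> (a \<noteq> 0 \<or> b \<noteq> s) \<or> a = 0 \<and> b = s + t \<or>
      a = N - 1 \<and> b = s \<or> s + t \<le> a \<and> b = Suc a \<and> b < N" for a b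
  have mem: "(a, b) \<in> parcs (R_graph k s t) \<longleftrightarrow> adj a b \<or> adj b a" for a b
    unfolding E adj_def Un_iff Diff_iff symcl_iff using s by auto
  have adjV: "a < N \<and> b < N" if "adj a b" for a b
    using that s t N by (auto simp: adj_def)
  let ?n = "2 * int k + 3"
  have type: "0 \<le> R_type k s t i" "R_type k s t i < ?n" if "i < N" for i
    using that k by (auto simp: R_type_def N_def)
  have cyc: "adj a b \<or> adj b a \<longleftrightarrow> cyc_adj ?n (R_type k s t a) (R_type k s t b)"
    if ab: "a < N" "b < N" for a b
  proof -
    have regions:
      "a = 0 \<or> (0 < a \<and> a < s) \<or> a = s \<or> (s < a \<and> a < s + t) \<or> s + t \<le> a"
      "b = 0 \<or> (0 < b \<and> b < s) \<or> b = s \<or> (s < b \<and> b < s + t) \<or> s + t \<le> b" by linarith+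
    \<comment> \<open>This removes the truncated subtraction, leaving the 25 pairs of regions to
      linear arithmetic.\<close>
    obtain m where m: "2 * k - 1 = Suc m" using k by (cases "2 * k - 1") auto
    have m': "2 * int k = int m + 2" using m by linarith
    from regions show ?thesis
      using s t ab N(1) unfolding adj_def cyc_adj_def R_type_def m m' by (elim disjE) auto
  qed
  have n: "int (2 * k + 3) = ?n" by simp
  have "(a, b) \<in> parcs (R_graph k s t) \<longleftrightarrow> (a, b) \<in> cycle_blowup (2 * k + 3) {0..<N} (R_type k s t)" for a b
  proof (cases "a < N \<and> b < N")
    case True
    then show ?thesis
      using type[of a] type[of b] cyc[of a b] unfolding mem by (subst cycle_blowup_cyc_adj) (simp_all add: n)
  next
    case False
    then show ?thesis using adjV unfolding mem by (auto simp: cycle_blowup_def)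
  qed
  then have "parcs (R_graph k s t) = cycle_blowup (2 * k + 3) {0..<N} (R_type k s t)" by auto
  then show ?thesis using V by (simp add: N_def)
qed

lemma R_graph_class_size:
  assumes s: "s \<ge> 1" and t: "t \<ge> 1" and k: "k \<ge> 1" and i: "0 \<le> i" "i < 2 * int k + 3"
  shows "class_size (2 * k + 3) {0..<s + t + 2 * k - 1} (R_type k s t) i =
    (if i = 1 then t - 1 else if i = 2 then s - 1 else 1)"
proof -
  define N where "N = s + t + 2 * k - 1"
  let ?n = "2 * int k + 3"
  have type: "0 \<le> R_type k s t j" "R_type k s t j < ?n" if "j < N" for j
    using that k by (auto simp: R_type_def N_def)
  have "{j \<in> {0..<N}. int (2 * k + 3) dvd R_type k s t j - i} = {j \<in> {0..<N}. R_type k s t j = i}"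
  proof -
    have "int (2 * k + 3) dvd R_type k s t j - i \<longleftrightarrow> R_type k s t j = i" if "j < N" for j
      using type[OF that] i by (simp add: mod_eq_dvd_iff[symmetric])
    then show ?thesis by auto
  qed
  also have "\<dots> = (if i = 0 then {0} else if i = 1 then {s + 1..<s + t} else if i = 2 then {1..<s}
      else if i = 3 then {s} else {nat (2 * int k + 2 + int s + int t - i)})"
    using s t k i by (auto simp: R_type_def N_def split: if_splits)
  finally show ?thesis unfolding class_size_def N_def[symmetric] by simp
qed

section \<open>Non-bipartiteness and excluded cycles in terms of closed walks\<close>

lemma bipartite_if_no_odd_closed_walk:
  assumes G: "graph_on V E" and no: "\<And>l a. odd l \<Longrightarrow> (a, a) \<notin> E ^^ l"
  shows "bipartite \<lparr>pverts = V, parcs = E\<rparr>"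
proof -
  note D = graph_onD[OF G]
  \<comment> \<open>The choice depends only on the set of vertices reachable from \<open>v\<close>,
    so adjacent vertices get the same root, one per component.\<close>
  define root where "root v = (SOME w. (v, w) \<in> E\<^sup>*)" for v
  have s: "sym (E\<^sup>*)" using D(5) by (rule sym_rtrancl)
  have root: "(v, root v) \<in> E\<^sup>*" for v unfolding root_def by (rule someI[of _ v]) simp
  have root_eq: "root u = root v" if "(u, v) \<in> E" for u v
  proof -
    have uv: "(u, v) \<in> E\<^sup>*" "(v, u) \<in> E\<^sup>*" using that D(7) by auto
    have "(u, w) \<in> E\<^sup>* \<longleftrightarrow> (v, w) \<in> E\<^sup>*" for w
      using rtrancl_trans[OF uv(1), of w] rtrancl_trans[OF uv(2), of w] by blast
    then show ?thesis by (simp add: root_def)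
  qed
  define U where "U = {v \<in> V. \<exists>l. even l \<and> (root v, v) \<in> E ^^ l}"
  have not_both: "\<not> (u \<in> U \<and> v \<in> U)" if uv: "(u, v) \<in> E" for u v
  proof
    assume "u \<in> U \<and> v \<in> U"
    then obtain l m where l: "even l" "(root u, u) \<in> E ^^ l" and m: "even m" "(root u, v) \<in> E ^^ m"
      using root_eq[OF uv] by (auto simp: U_def)
    have "(root u, v) \<in> E ^^ Suc l" using relpow_Suc_I[OF l(2) uv] .
    then have "(root u, root u) \<in> E ^^ (Suc l + m)"
      using relpow_sym[OF D(5) m(2)] unfolding relpow_add by blast
    then show False using no[of "Suc l + m"] l(1) m(1) by simp
  qed
  have one: "u \<in> U \<or> v \<in> U" if uv: "(u, v) \<in> E" for u v
  proof -
    have "(root u, u) \<in> E\<^sup>*" using root[of u] s by (blast dest: symD)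
    then obtain l where l: "(root u, u) \<in> E ^^ l" using rtrancl_imp_relpow by blast
    show ?thesis
    proof (cases "even l")
      case True
      then show ?thesis using l D(9)[OF uv] by (auto simp: U_def)
    next
      case False
      have "(root v, v) \<in> E ^^ Suc l" using relpow_Suc_I[OF l uv] root_eq[OF uv] by simp
      moreover have "even (Suc l)" using False by simp
      ultimately show ?thesis using D(9)[OF uv] unfolding U_def by blast
    qed
  qed
  have "E \<subseteq> U \<times> (V - U) \<union> (V - U) \<times> U"
  proof (rule subrelI)
    fix u v assume uv: "(u, v) \<in> E"
    show "(u, v) \<in> U \<times> (V - U) \<union> (V - U) \<times> U"
      using not_both[OF uv] one[OF uv] D(9)[OF uv] by blast
  qed
  moreover have "V = U \<union> (V - U)" by (auto simp: U_def)
  ultimately show ?thesis unfolding bipartite_def by (intro exI[of _ U] exI[of _ "V - U"]) auto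
qed

lemma cycle_graph_arcs:
  "parcs (cycle_graph m) = {(i, Suc i mod m) | i. i < m} \<union> {(Suc i mod m, i) | i. i < m}"
proof -
  have "(a, b) \<in> parcs (cycle_graph m) \<longleftrightarrow>
      (a, b) \<in> {(i, Suc i mod m) | i. i < m} \<union> {(Suc i mod m, i) | i. i < m}" for a b
    unfolding cycle_graph_def by (simp add: symcl_iff)
  then show ?thesis by (intro equalityI subrelI) blast+
qed

lemma pair_graph_cycle:
  assumes "m \<ge> 3"
  shows "pair_graph (cycle_graph m)"
proof -
  have "graph_on {0..<m} (parcs (cycle_graph m))"
    unfolding graph_on_def
  proof (intro conjI)
    have "Suc i mod m < m" for i using assms by simp
    then show "parcs (cycle_graph m) \<subseteq> {0..<m} \<times> {0..<m}"
      using assms by (auto simp: cycle_graph_arcs)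
    show "sym (parcs (cycle_graph m))"
      using assms by (auto simp: cycle_graph_arcs sym_def)
    have "Suc i mod m \<noteq> i" if "i < m" for i
      using that assms by (cases "Suc i = m") auto
    then show "irrefl (parcs (cycle_graph m))"
      using assms by (auto simp: cycle_graph_arcs irrefl_def, metis)
  qed (use assms in auto)
  then have "pair_graph \<lparr>pverts = {0..<m}, parcs = parcs (cycle_graph m)\<rparr>"
    by (subst pair_graph_iff_graph_on) (use assms in auto)
  then show ?thesis by (simp add: cycle_graph_def)
qed

context shortest_odd_walk
begin

lemma contains_cycle:
  shows "contains_subgraph \<lparr>pverts = V, parcs = E\<rparr> (cycle_graph g)"
proof -
  have g3: "g \<ge> 3"
  proof (rule ccontr)
    assume "\<not> g \<ge> 3"
    then have "g = 1" using odd_g by presburger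
    then show False using step[of 0] period[of 0] GD(8) by simp
  qed
  define h where "h i = f (int i)" for i
  have inj: "inj_on h {0..<g}"
  proof (rule inj_onI)
    fix i j assume ij: "i \<in> {0..<g}" "j \<in> {0..<g}" "h i = h j"
    then have "int g dvd int j - int i" by (simp add: h_def f_eq_iff)
    then have "int j mod int g = int i mod int g" by (simp add: mod_eq_dvd_iff)
    then show "i = j" using ij by simp
  qed
  let ?C = "\<lparr>pverts = h ` {0..<g}, parcs = map_prod h h ` parcs (cycle_graph g)\<rparr>"
  have h_mod: "h (Suc i mod g) = f (int i + 1)" for i
  proof -
    have "int g dvd int i + 1 - int (Suc i mod g)"
      by (simp add: of_nat_mod mod_eq_dvd_iff[symmetric] add.commute)
    then show ?thesis unfolding h_def f_eq_iff[symmetric] by simp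
  qed
  have sub: "parcs ?C \<subseteq> E"
    using step GD(7) g3 by (auto simp: cycle_graph_arcs h_mod) (auto simp: h_def)
  have V: "h ` {0..<g} \<subseteq> V" using f_in_V by (auto simp: h_def)
  interpret C: pair_graph "cycle_graph g" by (rule pair_graph_cycle[OF g3])
  have G': "graph_on {0..<g} (parcs (cycle_graph g))"
    using C.pair_graph_axioms pair_graph_iff_graph_on[of "{0..<g}" "parcs (cycle_graph g)"] g3
    by (simp add: cycle_graph_def)
  have "pair_graph ?C"
    using graph_on_image[OF G' inj] g3 by (subst pair_graph_iff_graph_on) auto
  moreover have "pair_graph \<lparr>pverts = V, parcs = E\<rparr>"
    using G GD(2) by (simp add: pair_graph_iff_graph_on)
  ultimately have "subgraph (with_proj ?C) (with_proj \<lparr>pverts = V, parcs = E\<rparr>)"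
    using sub V unfolding subgraph_def compatible_def wf_digraph_wp_iff
    by (simp add: pair_graph_def pair_digraph_def pair_fin_digraph_def)
  moreover have "digraph_iso (with_proj (cycle_graph g)) (with_proj ?C)"
    unfolding digraph_iso_with_proj_iff[OF C.pair_graph_axioms]
    using inj by (intro exI[of _ h]) (simp add: cycle_graph_def)
  ultimately show ?thesis unfolding contains_subgraph_def by blast
qed

end

lemma shortest_odd_walk_exists:
  assumes G: "graph_on V E" and odd: "odd l" "(a, a) \<in> E ^^ l"
  shows "\<exists>g f. shortest_odd_walk V E g f"
proof -
  define g where "g = (LEAST l. odd l \<and> (\<exists>a. (a, a) \<in> E ^^ l))"
  have g: "odd g \<and> (\<exists>a. (a, a) \<in> E ^^ g)"
    unfolding g_def by (rule LeastI[of _ l]) (use odd in blast)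
  have least: "(a, a) \<notin> E ^^ l" if "odd l" "l < g" for l a
    using not_less_Least[of l "\<lambda>l. odd l \<and> (\<exists>a. (a, a) \<in> E ^^ l)"] that unfolding g_def by blast
  obtain b where "(b, b) \<in> E ^^ g" using g by blast
  then obtain f where "\<forall>i. (f i, f (i + 1)) \<in> E" "\<forall>i. f (i + int g) = f i"
    using closed_walk_periodic odd_pos g by metis
  then have "shortest_odd_walk V E g f"
    using G g least by unfold_locales auto
  then show ?thesis by blast
qed

text \<open>A shortest odd closed walk traces a cycle, so the excluded cycles force its length above
  \<open>2 * k + 1\<close>, and with it the length of every odd closed walk.\<close>

lemma admissible_if_no_short_odd_cycles:
  assumes G: "graph_on V E" and nb: "\<not> bipartite \<lparr>pverts = V, parcs = E\<rparr>"
    and nc: "\<forall>l\<in>{1..k}. \<not> contains_subgraph \<lparr>pverts = V, parcs = E\<rparr> (cycle_graph (2 * l + 1))"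
  shows "admissible k V E"
proof -
  obtain l a where la: "odd l" "(a, a) \<in> E ^^ l"
    using bipartite_if_no_odd_closed_walk[OF G] nb by blast
  obtain g f where "shortest_odd_walk V E g f" using shortest_odd_walk_exists[OF G la] by blast
  then interpret shortest_odd_walk V E g f .
  have "g > 2 * k + 1"
  proof (rule ccontr)
    assume *: "\<not> g > 2 * k + 1"
    obtain j where j: "g = 2 * j + 1" using odd_g by (elim oddE)
    have "j \<noteq> 0"
    proof
      assume "j = 0"
      then show False using j step[of 0] period[of 0] GD(8) by simp
    qed
    then have "j \<in> {1..k}" using j * by simp
    then show False using nc contains_cycle j by auto
  qed
  then show ?thesis unfolding admissible_def using G la shortest by fastforce
qed

section \<open>Recognising the extremal graphs as
  \<open>R\<^sub>k(K\<^sub>s\<^sub>,\<^sub>t)\<close>\<close>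

lemma extremal_structure:
  assumes ext: "extremal k V E" and k: "k \<ge> 1"
  shows "\<exists>\<tau> p q. E = cycle_blowup (2 * k + 3) V \<tau> \<and> p \<ge> 1 \<and> p \<le> q \<and> q \<le> p + 1 \<and> card V = p + q + 2 * k + 1 \<and>
    (\<forall>i. 0 \<le> i \<longrightarrow> i < 2 * int k + 3 \<longrightarrow>
      class_size (2 * k + 3) V \<tau> i = (if i = 1 then q else if i = 2 then p else 1))"
proof -
  have G: "graph_on V E" using ext by (rule extremal_graph_on)
  obtain x where x: "perron V E x" using perron_exists[OF G] by blast
  obtain l a where la: "odd l" "(a, a) \<in> E ^^ l" using ext by (auto simp: extremal_def admissible_def)
  obtain g f where "shortest_odd_walk V E g f" using shortest_odd_walk_exists[OF G la] by blast
  then interpret W: shortest_odd_walk V E g f .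
  have "(f 0, f 0) \<in> E ^^ g" using W.path[of 0 g] W.period[of 0] by simp
  then have "\<not> g \<le> 2 * k + 1" using ext W.odd_g by (auto simp: extremal_def admissible_def)
  then have g: "g \<ge> 2 * k + 3" using W.odd_g by presburger
  interpret extremal_cycle V E g f k x
    by unfold_locales (use g k ext x in auto)
  note g_eq = girth_eq
  have main: "\<exists>p q. E = cycle_blowup (2 * k + 3) V \<tau> \<and> p \<ge> 1 \<and> p \<le> q \<and> q \<le> p + 1 \<and> card V = p + q + 2 * k + 1 \<and>
    (\<forall>i. 0 \<le> i \<longrightarrow> i < 2 * int k + 3 \<longrightarrow>
      class_size (2 * k + 3) V \<tau> i = (if i = 1 then q else if i = 2 then p else 1))"
    if \<tau>: "typing \<tau>" and le: "class_size g V \<tau> 2 \<le> class_size g V \<tau> 1"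
      "class_size g V \<tau> 1 \<le> class_size g V \<tau> 2 + 1" for \<tau>
  proof -
    define n where "n = int g"
    have n: "n = 2 * int k + 3" "n \<ge> 5" using g_eq k by (auto simp: n_def)
    define C where "C i = {v \<in> V. \<tau> v mod n = i}" for i
    have C: "class_size g V \<tau> i = card (C i)" if "0 \<le> i" "i < n" for i
      using that by (simp add: class_size_def C_def n_def mod_eq_dvd_iff[symmetric])
    have ne: "C i \<noteq> {}" if "0 \<le> i" "i < n" for i
      using typing_onto[OF \<tau>] that by (force simp: C_def n_def)
    have fin: "finite (C i)" for i using W.GD(1) by (simp add: C_def)
    have C1: "card (C i) = 1" if i: "0 \<le> i" "i < n" "i \<noteq> 1" "i \<noteq> 2" for i
    proof -
      obtain v where v: "v \<in> C i" using ne i by blast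
      have "w = v" if "w \<in> C i" for w
        using typing_unique[OF \<tau>, of w v] that v i by (simp add: C_def n_def)
      then have "C i = {v}" using v by blast
      then show ?thesis by simp
    qed
    have "card V = card (\<Union>i\<in>{0..<n}. C i)"
      using n(2) by (intro arg_cong[where f = card]) (auto simp: C_def)
    also have "\<dots> = (\<Sum>i\<in>{0..<n}. card (C i))"
      using fin by (intro card_UN_disjoint) (auto simp: C_def)
    also have "{0..<n} = insert 1 (insert 2 ({0..<n} - {1, 2}))" using n(2) by auto
    also have "(\<Sum>i\<in>\<dots>. card (C i)) = card (C 1) + (card (C 2) + (\<Sum>i\<in>{0..<n} - {1, 2}. card (C i)))"
      by simp
    also have "(\<Sum>i\<in>{0..<n} - {1, 2}. card (C i)) = (\<Sum>i\<in>{0..<n} - {1, 2}. 1)"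
      by (rule sum.cong) (use C1 in auto)
    also have "\<dots> = 2 * k + 1" using n by (simp add: card_Diff_subset)
    finally have card: "card V = card (C 2) + card (C 1) + 2 * k + 1" by simp
    show ?thesis
    proof (intro exI conjI allI impI)
      show "E = cycle_blowup (2 * k + 3) V \<tau>" using typing_cycle_blowup(1)[OF \<tau>] g_eq by simp
      show "card (C 2) \<ge> 1" using ne[of 2] fin n(2) by (simp add: Suc_le_eq card_gt_0_iff)
      show "card (C 2) \<le> card (C 1)" "card (C 1) \<le> card (C 2) + 1"
        using le C[of 1] C[of 2] n(2) by simp_all
      show "card V = card (C 2) + card (C 1) + 2 * k + 1" by (rule card)
      fix i :: int assume "0 \<le> i" "i < 2 * int k + 3"
      then show "class_size (2 * k + 3) V \<tau> i = (if i = 1 then card (C 1) else if i = 2 then card (C 2) else 1)"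
        using C[of i] C1[of i] n g_eq by auto
    qed
  qed
  obtain \<tau> where \<tau>: "typing \<tau>" using typing_exists by blast
  \<comment> \<open>One of \<open>\<tau>\<close> and its reflection has the class of type 2 no
    larger than that of type 1, matching the part that is rounded down.\<close>
  define \<rho> where "\<rho> v = 3 - \<tau> v" for v
  have \<rho>: "typing \<rho>" using typing_reflect[OF \<tau>] by (simp add: \<rho>_def[abs_def])
  have refl: "class_size g V \<rho> i = class_size g V \<tau> (3 - i)" for i
  proof -
    have "int g dvd 3 - \<tau> v - i \<longleftrightarrow> int g dvd \<tau> v - (3 - i)" for v
      using dvd_diff_commute[of "int g" "3 - i" "\<tau> v"] by (simp add: algebra_simps)
    then show ?thesis by (simp add: class_size_def \<rho>_def)
  qed
  have "class_size g V \<rho> 1 = class_size g V \<tau> 2" "class_size g V \<rho> 2 = class_size g V \<tau> 1"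
    by (simp_all add: refl)
  moreover note class_sizes_near[OF \<tau>] class_sizes_near[OF \<rho>]
  ultimately show ?thesis
    using main[OF \<tau>] main[OF \<rho>] by (cases "class_size g V \<tau> 2 \<le> class_size g V \<tau> 1") force+
qed

lemma extremal_iso_R_graph:
  assumes ext: "extremal k V E" and k: "k \<ge> 1" and N: "N = card V - 2 * k + 1"
    and s: "s = N div 2" and t: "t = N - s"
  shows "digraph_iso (with_proj \<lparr>pverts = V, parcs = E\<rparr>) (with_proj (R_graph k s t))"
    and "lambda1 (R_graph k s t) = lam V E"
proof -
  have G: "graph_on V E" using ext by (rule extremal_graph_on)
  note D = graph_onD[OF G]
  obtain \<tau> p q where E: "E = cycle_blowup (2 * k + 3) V \<tau>" and pq: "p \<ge> 1" "p \<le> q" "q \<le> p + 1"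
    "card V = p + q + 2 * k + 1"
    and cls: "\<And>i. 0 \<le> i \<Longrightarrow> i < 2 * int k + 3 \<Longrightarrow>
      class_size (2 * k + 3) V \<tau> i = (if i = 1 then q else if i = 2 then p else 1)"
    using extremal_structure[OF ext k] by blast
  \<comment> \<open>Each part of the complete bipartite graph is one class together with one end of
    the replaced edge. Here \<open>N = p + q + 2\<close> with \<open>q\<close> equal to
    \<open>p\<close> or \<open>p + 1\<close>, so halving gives \<open>p + 1\<close>.\<close>
  have st: "s = p + 1" "t = q + 1" using s t N pq by auto
  let ?V' = "{0..<s + t + 2 * k - 1}"
  have "\<exists>h. inj_on h V \<and> ?V' = h ` V \<and>
      cycle_blowup (2 * k + 3) ?V' (R_type k s t) = map_prod h h ` cycle_blowup (2 * k + 3) V \<tau>"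
    by (rule cycle_blowup_isomorphic) (use D(1) cls R_graph_class_size[of s t k] st k in auto)
  then obtain h where h: "inj_on h V" "?V' = h ` V"
    "cycle_blowup (2 * k + 3) ?V' (R_type k s t) = map_prod h h ` E" unfolding E by blast
  have R: "R_graph k s t = \<lparr>pverts = h ` V, parcs = map_prod h h ` E\<rparr>"
    using R_graph_eq_cycle_blowup[of s t k] st k h(2,3) by simp
  have "pair_graph \<lparr>pverts = V, parcs = E\<rparr>" using G D(2) by (simp add: pair_graph_iff_graph_on)
  then show "digraph_iso (with_proj \<lparr>pverts = V, parcs = E\<rparr>) (with_proj (R_graph k s t))"
    unfolding digraph_iso_with_proj_iff[OF \<open>pair_graph _\<close>] R using h(1) by auto
  show "lambda1 (R_graph k s t) = lam V E" unfolding R by (rule lam_image[OF G h(1)])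
qed

lemma digraph_iso_lambda1:
  assumes "pair_graph G" "pverts G \<noteq> {}" "digraph_iso (with_proj G) (with_proj H)"
  shows "lambda1 G = lambda1 H"
proof -
  have G_eq: "G = \<lparr>pverts = pverts G, parcs = parcs G\<rparr>" by simp
  have G: "graph_on (pverts G) (parcs G)"
    using assms(1) G_eq pair_graph_iff_graph_on[OF assms(2), of "parcs G"] by metis
  obtain h where h: "inj_on h (pverts G)" "pverts H = h ` pverts G" "parcs H = map_prod h h ` parcs G"
    using assms(3) unfolding digraph_iso_with_proj_iff[OF assms(1)] by blast
  then have "H = \<lparr>pverts = h ` pverts G, parcs = map_prod h h ` parcs G\<rparr>" by simp
  then show ?thesis using lam_image[OF G h(1)] G_eq by metis
qed

lemma extremal_exists:
  assumes "admissible k V E"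
  shows "\<exists>E'. extremal k V E'"
proof -
  let ?S = "{E'. admissible k V E'}"
  have "?S \<subseteq> Pow (V \<times> V)" by (auto simp: admissible_def graph_on_def)
  moreover have "finite V" using assms by (simp add: admissible_def graph_on_def)
  ultimately have fin: "finite ?S" by (meson finite_Pow_iff finite_SigmaI finite_subset)
  have "Max (lam V ` ?S) \<in> lam V ` ?S" using fin assms by (intro Max_in) auto
  then obtain E' where E': "admissible k V E'" "lam V E' = Max (lam V ` ?S)" by auto
  have "lam V E'' \<le> lam V E'" if "admissible k V E''" for E''
    unfolding E'(2) using fin that by (intro Max_ge) auto
  then show ?thesis using E'(1) unfolding extremal_def by blast
qed

theorem theorem1p4:
  fixes G :: "'a pair_pre_digraph" and k n :: nat
  assumes "k \<ge> 1"
    and "pair_graph G"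
    and "card (pverts G) = n"
    and "n \<ge> 2 * k + 4"
    and "\<not> bipartite G"
    and "\<forall>l\<in>{1..k}. \<not> contains_subgraph G (cycle_graph (2 * l + 1))"
  shows "lambda1 G \<le> lambda1 (R_graph k (nat \<lfloor>real (n - 2 * k + 1) / 2\<rfloor>) (nat \<lceil>real (n - 2 * k + 1) / 2\<rceil>))
    \<and> (lambda1 G = lambda1 (R_graph k (nat \<lfloor>real (n - 2 * k + 1) / 2\<rfloor>) (nat \<lceil>real (n - 2 * k + 1) / 2\<rceil>))
       \<longleftrightarrow> digraph_iso (with_proj G)
             (with_proj (R_graph k (nat \<lfloor>real (n - 2 * k + 1) / 2\<rfloor>) (nat \<lceil>real (n - 2 * k + 1) / 2\<rceil>))))"
proof -
  define V E N s t where "V = pverts G" and "E = parcs G" and "N = n - 2 * k + 1"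
    and "s = N div 2" and "t = N - s"
  have G_eq: "G = \<lparr>pverts = V, parcs = E\<rparr>" by (simp add: V_def E_def)
  have "V \<noteq> {}" using assms(3,4) by (auto simp: V_def)
  then have G: "graph_on V E" using assms(2) pair_graph_iff_graph_on[of V E] G_eq by simp
  have "\<lfloor>real N / 2\<rfloor> = int (N div 2)"
    using floor_divide_of_nat_eq[of N 2, where 'a = real] by simp
  moreover have "\<lceil>real N / 2\<rceil> = int (N - N div 2)"
    by (rule ceiling_unique) (auto simp: of_nat_diff real_of_nat_div field_simps)
  ultimately have st: "nat \<lfloor>real (n - 2 * k + 1) / 2\<rfloor> = s" "nat \<lceil>real (n - 2 * k + 1) / 2\<rceil> = t"
    unfolding N_def[symmetric] s_def t_def by (simp_all only: nat_int)
  have N: "N = card V - 2 * k + 1" using assms(3) by (simp add: N_def V_def)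
  have admissible: "admissible k V E"
    using admissible_if_no_short_odd_cycles[OF G] assms(5,6) unfolding G_eq by blast
  obtain E' where E': "extremal k V E'" using extremal_exists[OF admissible] by blast
  note R = extremal_iso_R_graph[OF _ assms(1) N s_def t_def]
  have le: "lambda1 G \<le> lambda1 (R_graph k s t)"
    using E' admissible unfolding R(2)[OF E'] by (simp add: G_eq extremal_def)
  have "digraph_iso (with_proj G) (with_proj (R_graph k s t))"
    if "lambda1 G = lambda1 (R_graph k s t)"
  proof -
    \<comment> \<open>A graph that attains the bound is itself extremal, so the structure result
      applies to it directly.\<close>
    have "lam V E = lam V E'" using that R(2)[OF E'] by (simp add: G_eq)
    then have "extremal k V E" using E' admissible by (simp add: extremal_def)
    then show ?thesis using R(1) by (simp add: G_eq)
  qed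
  moreover have "lambda1 G = lambda1 (R_graph k s t)"
    if "digraph_iso (with_proj G) (with_proj (R_graph k s t))"
    using digraph_iso_lambda1[OF assms(2) _ that] \<open>V \<noteq> {}\<close> by (simp add: V_def)
  ultimately show ?thesis unfolding st using le by blast
qed

end
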